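(* The matrix $\Gamma(z;\lambda)$ defined in the context is analytic for $\lambda\in\overline{\mathbb{C}}\setminus[-1/2,1/2]$ and can be analytically continued (in $\lambda$) across the intervals $(-1/2,0)$ and $(0,1/2)$ from above and from below.
   Context: Fix real numbers $b_L<0<b_R$; $z\in\overline{\mathbb C}\setminus[b_L,b_R]$ is a fixed parameter. $\overline{\mathbb C}=\mathbb C\cup\{\infty\}$, $\sigma_2=\begin{bmatrix}0&-i\\ i&0\end{bmatrix}$. $a=a(\lambda)=\frac{1}{i\pi}\ln\left(\frac{i+\sqrt{4\lambda^2-1}}{2\lambda}\right)$ with the principal logarithm and $\sqrt{4\lambda^2-1}$ analytic off $[-1/2,1/2]$ with $\sqrt{4\lambda^2-1}=2\lambda+O(1)$ as $\lambda\to\infty$. $h_\infty(\eta)=e^{a\pi i}\eta^{-a}{}_2F_1(a,a+1;2a+2;\frac1\eta)$, $s_\infty(\eta)=-e^{-a\pi i}\eta^{a+1}{}_2F_1(-a-1,-a;-2a;\frac1\eta)$ for $\operatorname{Im}\eta>0$ with principal branches, extended to $\mathbb C\setminus((-\infty,0]\cup[1,\infty))$ by analytic continuation across $(0,1)$; prime is $d/d\eta$. $\hat\Gamma(\eta)=\begin{bmatrix} h_\infty(\eta) & s_\infty(\eta) \\ h_\infty'(\eta) & s_\infty'(\eta) \end{bmatrix}$, $M_1(z)=\frac{b_R(z-b_L)}{z(b_R-b_L)}$, $$Q(\lambda)=\begin{bmatrix} -\tan(a\pi) & 0 \\ 0 & 4^{2a+1}e^{a\pi i}\frac{\Gamma(a+3/2)\Gamma(a+1/2)}{\Gamma(a)\Gamma(a+2)}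 \end{bmatrix}\begin{bmatrix} 1 & e^{a\pi i} \\ -e^{a\pi i} & 1 \end{bmatrix}$$ (here $\Gamma(\cdot)$ with one argument is Euler's Gamma function), and $$\Gamma(z;\lambda)=\sigma_2Q^{-1}(\lambda)\hat{\Gamma}^{-1}\left(M_1(\infty)\right)\begin{bmatrix} 1 & \frac{b_Lb_R}{z(b_R-b_L)(a+1)} \\ 0 & 1 \end{bmatrix}\hat{\Gamma}\left(M_1(z)\right)Q(\lambda)\sigma_2,$$ the value at $\lambda=\infty$ being understood as the limit. "Continued from above (below)" means that the restriction of $\Gamma(z;\cdot)$ to the upper (lower) half-plane extends analytically to a neighbourhood of each point of the open interval; the two continuations need not coincide. *)

theory Defs
  imports "HOL-Analysis.Analysis" "HOL-Library.Landau_Symbols"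
begin

datatype csphere = Fin complex | Infty

text \<open>Analyticity at \<^term>\<open>Infty\<close> is analyticity at \<open>0\<close> in the local coordinate \<open>w = 1/\<lambda>\<close>.\<close>

definition sphere_analytic_on :: "(csphere \<Rightarrow> complex) \<Rightarrow> csphere set \<Rightarrow> bool" where
  "sphere_analytic_on f S \<longleftrightarrow>
     (\<lambda>z. f (Fin z)) analytic_on {z. Fin z \<in> S} \<and>
     (Infty \<in> S \<longrightarrow> (\<lambda>w. if w = 0 then f Infty else f (Fin (1 / w))) analytic_on {0})"

definition seg :: "real \<Rightarrow> real \<Rightarrow> csphere set" where
  "seg s t = (\<lambda>x. Fin (complex_of_real x)) ` {s..t}"

definition is_sqrt_branch :: "(complex \<Rightarrow> complex) \<Rightarrow> bool" where
  "is_sqrt_branch r \<longleftrightarrow>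
     r analytic_on (- complex_of_real ` {-1/2..1/2}) \<and>
     (\<forall>l \<in> - complex_of_real ` {-1/2..1/2}. (r l)\<^sup>2 = 4 * l\<^sup>2 - 1) \<and>
     (\<lambda>l. r l - 2 * l) \<in> O[at_infinity](\<lambda>_. 1)"

definition sqrt_branch :: "complex \<Rightarrow> complex" where
  "sqrt_branch = (SOME r. is_sqrt_branch r)"

lemma is_sqrt_branch_explicit:
  "is_sqrt_branch (\<lambda>l. 2 * l * csqrt (1 - 1 / (4 * l\<^sup>2)))"
proof -
  define S where "S = - complex_of_real ` {-1/2..1/2}"
  have nz: "l \<noteq> 0" if "l \<in> S" for l
    using that by (force simp: S_def image_iff)
  have slit: "1 - 1 / (4 * l\<^sup>2) \<notin> \<real>\<^sub>\<le>\<^sub>0" if l: "l \<in> S" for l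
  proof
    assume "1 - 1 / (4 * l\<^sup>2) \<in> \<real>\<^sub>\<le>\<^sub>0"
    then obtain t where t: "t \<le> 0" "1 - 1 / (4 * l\<^sup>2) = complex_of_real t"
      by (auto elim: nonpos_Reals_cases)
    define y where "y = sqrt (1 / (4 * (1 - t)))"
    have eq: "1 / (4 * l\<^sup>2) = complex_of_real (1 - t)"
      using t(2) by (simp add: algebra_simps)
    have "l\<^sup>2 = complex_of_real (1 / (4 * (1 - t)))"
      using eq nz[OF l] t(1) by (auto simp: field_simps)
    also have "\<dots> = (complex_of_real y)\<^sup>2"
      unfolding of_real_power[symmetric] y_def using t(1) by simp
    finally have "l = of_real y \<or> l = of_real (- y)"
      by (auto simp: power2_eq_iff)
    moreover have "\<bar>y\<bar> \<le> 1/2"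
    proof -
      have "1 / (4 * (1 - t)) \<le> (1/2)\<^sup>2"
        using t(1) by (simp add: field_simps power2_eq_square)
      then have "y \<le> 1/2"
        unfolding y_def by (rule real_le_lsqrt[rotated]) simp
      moreover have "0 \<le> y" using t(1) by (simp add: y_def)
      ultimately show ?thesis by simp
    qed
    ultimately have "l \<in> complex_of_real ` {-1/2..1/2}"
      by (auto simp: image_iff intro: bexI[of _ y] bexI[of _ "- y"])
    with l show False by (simp add: S_def)
  qed
  have "(\<lambda>l. 2 * l * csqrt (1 - 1 / (4 * l\<^sup>2))) analytic_on S"
    using nz slit by (intro analytic_intros) auto
  moreover have "\<forall>l\<in>S. (2 * l * csqrt (1 - 1 / (4 * l\<^sup>2)))\<^sup>2 = 4 * l\<^sup>2 - 1"
    using nz by (auto simp: power_mult_distrib field_simps)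
  moreover have "(\<lambda>l. 2 * l * csqrt (1 - 1 / (4 * l\<^sup>2)) - 2 * l) \<in> O[at_infinity](\<lambda>_. 1)"
  proof (rule bigoI[where c = 1])
    have "norm (2 * l * csqrt (1 - 1 / (4 * l\<^sup>2)) - 2 * l) \<le> 1" if l: "1 \<le> norm l" for l
    proof -
      define r where "r = csqrt (1 - 1 / (4 * l\<^sup>2))"
      have l0: "l \<noteq> 0" using l by auto
      have "0 \<le> Re r" using csqrt_principal[of "1 - 1 / (4 * l\<^sup>2)"] by (auto simp: r_def)
      then have "1 \<le> norm (r + 1)"
        using complex_Re_le_cmod[of "r + 1"] by simp
      have "(r - 1) * (r + 1) = - 1 / (4 * l\<^sup>2)"
        by (simp add: algebra_simps power2_eq_square[symmetric] r_def)
      then have "norm (r - 1) * norm (r + 1) = 1 / (4 * (norm l)\<^sup>2)"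
        by (simp add: norm_mult[symmetric] norm_divide norm_power)
      moreover have "norm (r - 1) * 1 \<le> norm (r - 1) * norm (r + 1)"
        using \<open>1 \<le> norm (r + 1)\<close> by (intro mult_left_mono) auto
      ultimately have "norm (r - 1) \<le> 1 / (4 * (norm l)\<^sup>2)" by simp
      then have "2 * norm l * norm (r - 1) \<le> 2 * norm l * (1 / (4 * (norm l)\<^sup>2))"
        by (intro mult_left_mono) auto
      also have "\<dots> \<le> 1" using l by (simp add: field_simps power2_eq_square)
      finally have "norm (2 * l * (r - 1)) \<le> 1" by (simp add: norm_mult)
      then show ?thesis by (simp add: r_def algebra_simps)
    qed
    then show "\<forall>\<^sub>F l in at_infinity. norm (2 * l * csqrt (1 - 1 / (4 * l\<^sup>2)) - 2 * l) \<le> 1 * norm (1::complex)"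
      unfolding eventually_at_infinity by auto
  qed
  ultimately show ?thesis unfolding is_sqrt_branch_def S_def by blast
qed

lemma is_sqrt_branch_sqrt_branch: "is_sqrt_branch sqrt_branch"
  using is_sqrt_branch_explicit unfolding sqrt_branch_def by (rule someI[where P = is_sqrt_branch])

definition a_exp :: "complex \<Rightarrow> complex" where
  "a_exp l = 1 / (\<i> * of_real pi) * Ln ((\<i> + sqrt_branch l) / (2 * l))"

text \<open>
  Principal branch of Gauss' hypergeometric function: the analytic continuation of the
  hypergeometric series from the unit disc to the plane cut along \<open>[1,\<infinity>)\<close>. It exists and is
  unique when \<open>c\<close> is not a non-positive integer; this is the only case that matters below,
  since \<open>a = a_exp \<lambda>\<close> satisfies \<open>\<bar>Re a\<bar> < 1/2\<close> and \<open>a \<noteq> 0\<close> for finite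
  \<open>\<lambda>\<close> off \<open>[-1/2,1/2]\<close>.
\<close>

definition hyp2F1 :: "complex \<Rightarrow> complex \<Rightarrow> complex \<Rightarrow> complex \<Rightarrow> complex" where
  "hyp2F1 a b c = (SOME F. F holomorphic_on (- complex_of_real ` {1..}) \<and>
     (\<forall>x \<in> ball 0 1. F x = eval_fps (fps_hypergeo [a, b] [c] 1) x))"

text \<open>
  Continuation from the upper half-plane, across \<open>(0,1)\<close>, to the doubly cut plane. That domain is
  connected and meets the real axis only in \<open>(0,1)\<close>, so the continuation is unique. In general it
  differs from \<open>f\<close> in the lower half-plane.
\<close>

definition cont_upper :: "(complex \<Rightarrow> complex) \<Rightarrow> complex \<Rightarrow> complex" where
  "cont_upper f = (SOME g. g holomorphic_on (- complex_of_real ` ({..0} \<union> {1..})) \<and>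
     (\<forall>\<eta>. 0 < Im \<eta> \<longrightarrow> g \<eta> = f \<eta>))"

definition h_inf :: "complex \<Rightarrow> complex \<Rightarrow> complex" where
  "h_inf a = cont_upper (\<lambda>\<eta>. exp (a * of_real pi * \<i>) * \<eta> powr (- a)
     * hyp2F1 a (a + 1) (2 * a + 2) (1 / \<eta>))"

definition s_inf :: "complex \<Rightarrow> complex \<Rightarrow> complex" where
  "s_inf a = cont_upper (\<lambda>\<eta>. - exp (- a * of_real pi * \<i>) * \<eta> powr (a + 1)
     * hyp2F1 (- a - 1) (- a) (- 2 * a) (1 / \<eta>))"

abbreviation mat2 :: "complex \<Rightarrow> complex \<Rightarrow> complex \<Rightarrow> complex \<Rightarrow> complex^2^2" where
  "mat2 p q r s \<equiv> vector [vector [p, q], vector [r, s]]"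

definition sigma2 :: "complex^2^2" where
  "sigma2 = mat2 0 (- \<i>) \<i> 0"

definition Gamma_hat :: "complex \<Rightarrow> complex \<Rightarrow> complex^2^2" where
  "Gamma_hat a \<eta> = mat2 (h_inf a \<eta>) (s_inf a \<eta>) (deriv (h_inf a) \<eta>) (deriv (s_inf a) \<eta>)"

text \<open>At \<^term>\<open>Infty\<close> the following two functions of \<open>z\<close> take their limits.\<close>

fun M1 :: "real \<Rightarrow> real \<Rightarrow> csphere \<Rightarrow> complex" where
  "M1 bL bR (Fin z) = (of_real bR * (z - of_real bL)) / (z * (of_real bR - of_real bL))"
| "M1 bL bR Infty = of_real bR / (of_real bR - of_real bL)"

fun upper_entry :: "real \<Rightarrow> real \<Rightarrow> complex \<Rightarrow> csphere \<Rightarrow> complex" where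
  "upper_entry bL bR a (Fin z) =
     (of_real bL * of_real bR) / (z * (of_real bR - of_real bL) * (a + 1))"
| "upper_entry bL bR a Infty = 0"

definition Q_mat :: "complex \<Rightarrow> complex^2^2" where
  "Q_mat a =
     mat2 (- tan (a * of_real pi)) 0
          0 (4 powr (2 * a + 1) * exp (a * of_real pi * \<i>)
               * (Gamma (a + 3/2) * Gamma (a + 1/2)) / (Gamma a * Gamma (a + 2)))
     ** mat2 1 (exp (a * of_real pi * \<i>)) (- exp (a * of_real pi * \<i>)) 1"

definition Gamma_fin :: "real \<Rightarrow> real \<Rightarrow> csphere \<Rightarrow> complex \<Rightarrow> complex^2^2" where
  "Gamma_fin bL bR z l = (let a = a_exp l in
     sigma2 ** matrix_inv (Q_mat a) ** matrix_inv (Gamma_hat a (M1 bL bR Infty))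
       ** mat2 1 (upper_entry bL bR a z) 0 1
       ** Gamma_hat a (M1 bL bR z) ** Q_mat a ** sigma2)"

fun Gamma_mat :: "real \<Rightarrow> real \<Rightarrow> csphere \<Rightarrow> csphere \<Rightarrow> complex^2^2" where
  "Gamma_mat bL bR z (Fin l) = Gamma_fin bL bR z l"
| "Gamma_mat bL bR z Infty = Lim at_infinity (Gamma_fin bL bR z)"

definition matrix_sphere_analytic_on :: "(csphere \<Rightarrow> complex^2^2) \<Rightarrow> csphere set \<Rightarrow> bool" where
  "matrix_sphere_analytic_on F S \<longleftrightarrow> (\<forall>i j. sphere_analytic_on (\<lambda>l. F l $ i $ j) S)"

definition extends_near :: "(complex \<Rightarrow> complex^2^2) \<Rightarrow> complex set \<Rightarrow> complex \<Rightarrow> bool" where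
  "extends_near F H x \<longleftrightarrow>
     (\<exists>U G. open U \<and> x \<in> U \<and> (\<forall>i j. (\<lambda>l. G l $ i $ j) analytic_on (H \<union> U)) \<and>
            (\<forall>l\<in>H. G l = F l))"

definition continues_from_above :: "(csphere \<Rightarrow> complex^2^2) \<Rightarrow> real set \<Rightarrow> bool" where
  "continues_from_above F I \<longleftrightarrow>
     (\<forall>x\<in>I. extends_near (\<lambda>l. F (Fin l)) {l. 0 < Im l} (complex_of_real x))"

definition continues_from_below :: "(csphere \<Rightarrow> complex^2^2) \<Rightarrow> real set \<Rightarrow> bool" where
  "continues_from_below F I \<longleftrightarrow>
     (\<forall>x\<in>I. extends_near (\<lambda>l. F (Fin l)) {l. Im l < 0} (complex_of_real x))"

end

theory Submission
  imports Defs "HOL-Complex_Analysis.Complex_Analysis" "HOL-Real_Asymp.Real_Asymp"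
begin

text \<open>
  The exponent satisfies \<open>sin (\<pi> a) = 1/(2\<lambda>)\<close>. Up to exponential factors, \<open>h\<^sub>\<infinity>\<close> and \<open>s\<^sub>\<infinity>\<close> are the
  functions \<open>\<eta>\<^sup>-\<^sup>b F(b,b+1;2b+2;1/\<eta>)\<close> for \<open>b = a\<close> and \<open>b = -a-1\<close>. They solve
  \<open>\<eta>(1-\<eta>) y'' + b(b+1) y = 0\<close>, where \<open>b(b+1)\<close> has the same value for both. The doubly cut plane is
  star-shaped about \<open>1/2\<close>, and a fundamental system there is entire in \<open>b(b+1)\<close>; so for fixed \<open>\<eta>\<close> the
  continued functions are analytic in \<open>b\<close>. Since the equation has no first-order term, the determinant
  of the fundamental matrix is constant, namely \<open>-(2a+1)\<close>. Conjugation by \<open>Q\<close> involves only the quotient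
  of its diagonal entries, whose singularity at \<open>a = 0\<close> is removable. Hence \<open>\<Gamma>(z;\<lambda>) = \<Phi>(a(\<lambda>))\<close> with \<open>\<Phi>\<close>
  analytic on \<open>\<bar>Re a\<bar> < 1\<close> except at \<open>\<plusminus>1/2\<close>. Off \<open>[-1/2,1/2]\<close> one has \<open>\<bar>Re a\<bar> < 1/2\<close>, the point
  \<open>\<lambda> = \<infinity>\<close> corresponds to \<open>a = 0\<close>, and from either side of the open intervals \<open>a\<close> continues to values
  with \<open>Re a = \<plusminus>1/2\<close> and \<open>Im a \<noteq> 0\<close>.
\<close>

text \<open>The exponent a = 0, which belongs to \<open>\<lambda> = \<infinity>\<close>, is
  degenerate for every ingredient: \<open>s_inf\<close> would need a hypergeometric function with
  lower parameter 0, \<open>Q_mat\<close> is singular, and the value of \<open>Gamma_mat\<close> is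
  only a limit. Each ingredient is therefore replaced by an analytic substitute that agrees with it
  for a \<noteq> 0 and still makes sense at a = 0; the limit then becomes a value of the substitute.

  A second obstacle is that \<open>hyp2F1\<close>, \<open>cont_upper\<close> and
  \<open>sqrt_branch\<close> are picked by \<open>SOME\<close>, so nothing can be read off about
  their dependence on the exponent until they are identified with explicit functions. The series in
  1/\<eta> cannot do this alone, because \<open>M1\<close> at infinity always lies in (0,1), where
  it does not converge. The differential equation bridges the gap: the coefficients with respect to
  the fundamental system are computed at one point where the series converges.

  The exceptional exponents 1/2 and -1/2 belong to the endpoints of the segment, since sin (\<pi> a)
  = 1/(2\<lambda>).\<close>

subsection \<open>Linear second-order equations on star-shaped domains\<close>

text \<open>Each integration along a ray raises the power of the distance by one and divides by the
  new exponent; iterated, this produces the factorials of the Picard bounds. It is the mean value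
  inequality along the segment, with \<open>\<phi>\<close> as majorant.\<close>

lemma primitive_bound:
  fixes f g :: "complex \<Rightarrow> complex"
  assumes der: "\<And>w. w \<in> closed_segment x y \<Longrightarrow> (g has_field_derivative f w) (at w)"
    and g0: "g x = 0"
    and bd: "\<And>w. w \<in> closed_segment x y \<Longrightarrow> norm (f w) \<le> C * norm (w - x) ^ k"
  shows "norm (g y) \<le> C * norm (y - x) ^ Suc k / real (Suc k)"
proof -
  define L where "L = norm (y - x)"
  define \<gamma> where "\<gamma> = (\<lambda>t::real. x + of_real t * (y - x))"
  have seg: "\<gamma> t \<in> closed_segment x y" if "0 \<le> t" "t \<le> 1" for t
    using that unfolding \<gamma>_def closed_segment_def
    by (auto simp: scaleR_conv_of_real algebra_simps intro!: exI[of _ t])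
  have d: "((g \<circ> \<gamma>) has_vector_derivative (y - x) * f (\<gamma> t)) (at t)" if "0 \<le> t" "t \<le> 1" for t
  proof (rule field_vector_diff_chain_at)
    show "(\<gamma> has_vector_derivative y - x) (at t)"
      unfolding \<gamma>_def has_vector_derivative_def
      by (auto intro!: derivative_eq_intros simp: scaleR_conv_of_real)
    show "(g has_field_derivative f (\<gamma> t)) (at (\<gamma> t))"
      using der seg that by blast
  qed
  define \<phi> where "\<phi> = (\<lambda>t::real. C * L ^ Suc k * t ^ Suc k / real (Suc k))"
  have p: "(\<phi> has_vector_derivative C * L ^ Suc k * t ^ k) (at t)" for t
    unfolding \<phi>_def has_real_derivative_iff_has_vector_derivative[symmetric]
    by (rule derivative_eq_intros refl | simp del: of_nat_Suc power_Suc)+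
  have "norm ((g \<circ> \<gamma>) 1 - (g \<circ> \<gamma>) 0) \<le> \<phi> 1 - \<phi> 0"
  proof (rule differentiable_bound_general[OF zero_less_one _ _ d p])
    show "continuous_on {0..1} (g \<circ> \<gamma>)"
      by (intro continuous_at_imp_continuous_on ballI has_vector_derivative_continuous[OF d]) auto
    show "continuous_on {0..1} \<phi>"
      by (intro continuous_at_imp_continuous_on ballI has_vector_derivative_continuous[OF p])
    fix t :: real assume t: "0 < t" "t < 1"
    have "norm (f (\<gamma> t)) \<le> C * norm (\<gamma> t - x) ^ k"
      using bd seg t by auto
    also have "norm (\<gamma> t - x) = t * L"
      using t by (simp add: \<gamma>_def L_def norm_mult)
    finally have "L * norm (f (\<gamma> t)) \<le> L * (C * (t * L) ^ k)"
      by (intro mult_left_mono) (auto simp: L_def)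
    then show "norm ((y - x) * f (\<gamma> t)) \<le> C * L ^ Suc k * t ^ k"
      unfolding norm_mult by (simp add: L_def power_mult_distrib mult_ac)
  qed auto
  then show ?thesis
    by (simp add: \<gamma>_def \<phi>_def g0 L_def del: of_nat_Suc)
qed

text \<open>The coefficient of the equation has poles on the boundary of the domains used below, so
  it is only bounded locally. A closed neighbourhood of one segment is compact and contains the
  segments to all nearby endpoints.\<close>

lemma segment_neighbourhood_bound:
  fixes p :: "complex \<Rightarrow> complex"
  assumes "open D" "closed_segment x0 x \<subseteq> D" "continuous_on D p"
  obtains d M where "0 < d" "0 \<le> M"
    "\<And>y. y \<in> ball x d \<Longrightarrow> closed_segment x0 y \<subseteq> D"
    "\<And>y w. y \<in> ball x d \<Longrightarrow> w \<in> closed_segment x0 y \<Longrightarrow> norm (p w) \<le> M"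
proof -
  obtain d where d: "d > 0" "(\<Union>w\<in>closed_segment x0 x. cball w d) \<subseteq> D"
    using compact_subset_open_imp_cball_epsilon_subset[OF compact_segment assms(1,2)] .
  define T where "T = {u + v | u v. u \<in> closed_segment x0 x \<and> v \<in> cball 0 d}"
  have "compact T" unfolding T_def by (intro compact_sums compact_segment compact_cball)
  have TD: "T \<subseteq> D"
    using d(2) unfolding T_def by (auto simp: dist_norm) (force simp: dist_norm)
  have seg: "closed_segment x0 y \<subseteq> T" if y: "y \<in> ball x d" for y
  proof
    fix w assume "w \<in> closed_segment x0 y"
    then obtain t where t: "0 \<le> t" "t \<le> 1" "w = (1 - t) *\<^sub>R x0 + t *\<^sub>R y"
      by (auto simp: closed_segment_def)
    have "w = ((1 - t) *\<^sub>R x0 + t *\<^sub>R x) + t *\<^sub>R (y - x)"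
      using t by (simp add: algebra_simps)
    moreover have "norm (t *\<^sub>R (y - x)) \<le> d"
    proof -
      have "t * norm (y - x) \<le> 1 * norm (y - x)" using t by (intro mult_right_mono) auto
      also have "\<dots> \<le> d" using y by (simp add: dist_norm norm_minus_commute)
      finally show ?thesis using t by simp
    qed
    moreover have "(1 - t) *\<^sub>R x0 + t *\<^sub>R x \<in> closed_segment x0 x"
      using t by (auto simp: closed_segment_def)
    ultimately show "w \<in> T"
      unfolding T_def mem_Collect_eq mem_cball_0 by blast
  qed
  have "bounded (p ` T)"
    using \<open>compact T\<close> TD assms(3)
    by (meson compact_continuous_image compact_imp_bounded continuous_on_subset)
  then obtain M where M: "0 < M" "\<And>w. w \<in> T \<Longrightarrow> norm (p w) \<le> M"
    by (force simp: bounded_pos)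
  show thesis
    using d(1) M(1) subset_trans[OF seg TD] M(2)[OF subsetD[OF seg]]
    by (intro that[of d M]) (assumption | simp)+
qed

text \<open>Picard iteration, organised as a power series in the spectral parameter \<open>c\<close>.\<close>

lemma linear_ode_entire_in_parameter:
  fixes p :: "complex \<Rightarrow> complex"
  assumes D: "open D" "x0 \<in> D" "\<And>x. x \<in> D \<Longrightarrow> closed_segment x0 x \<subseteq> D"
    and p: "p holomorphic_on D"
  obtains U U' where
    "\<And>c x. x \<in> D \<Longrightarrow> (U c has_field_derivative U' c x) (at x)"
    "\<And>c x. x \<in> D \<Longrightarrow> (U' c has_field_derivative c * p x * U c x) (at x)"
    "\<And>c. U c x0 = A" "\<And>c. U' c x0 = B"
    "\<And>x. x \<in> D \<Longrightarrow> (\<lambda>c. U c x) holomorphic_on UNIV"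
    "\<And>x. x \<in> D \<Longrightarrow> (\<lambda>c. U' c x) holomorphic_on UNIV"
proof -
  have "\<exists>g. (\<forall>x\<in>D. (g has_field_derivative f x) (at x)) \<and> g x0 = 0" if "f holomorphic_on D" for f
  proof -
    have "starlike D" using D by (auto simp: starlike_def)
    then have "\<exists>g. \<forall>x\<in>D. (g has_field_derivative f x) (at x)"
      using that D(1)
      by (intro holomorphic_starlike_primitive[of D f "{}"])
         (auto intro: holomorphic_on_imp_continuous_on holomorphic_on_imp_differentiable_at)
    then obtain g where g: "\<And>x. x \<in> D \<Longrightarrow> (g has_field_derivative f x) (at x)"
      by blast
    show ?thesis
      by (rule exI[of _ "\<lambda>x. g x - g x0"]) (auto intro!: derivative_eq_intros g)
  qed
  then obtain prim where prim: "\<And>f x. f holomorphic_on D \<Longrightarrow> x \<in> D \<Longrightarrow> (prim f has_field_derivative f x) (at x)"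
    and prim0: "\<And>f. f holomorphic_on D \<Longrightarrow> prim f x0 = 0"
    by metis
  \<comment> \<open>Comparing powers of c in U'' = c p U: \<open>u 0\<close> is the affine function
    with the given initial data, and \<open>u (Suc n)\<close> solves u'' = p * \<open>u n\<close>
    with zero data. \<open>v n\<close> is the derivative of \<open>u n\<close>.\<close>
  define u where "u = rec_nat (\<lambda>x. A + B * (x - x0)) (\<lambda>_ g. prim (prim (\<lambda>x. p x * g x)))"
  define v where "v = (\<lambda>n. case n of 0 \<Rightarrow> (\<lambda>_. B) | Suc m \<Rightarrow> prim (\<lambda>x. p x * u m x))"
  have u0: "u 0 = (\<lambda>x. A + B * (x - x0))" and uS: "u (Suc n) = prim (v (Suc n))"
    and v0: "v 0 = (\<lambda>_. B)" and vS: "v (Suc n) = prim (\<lambda>x. p x * u n x)" for n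
    by (simp_all add: u_def v_def)
  have primh: "prim f holomorphic_on D" if "f holomorphic_on D" for f
    using prim[OF that] D(1) holomorphic_on_open by blast
  have uh: "u n holomorphic_on D" for n
  proof (induction n)
    case 0 show ?case unfolding u0 by (intro holomorphic_intros)
  next
    case (Suc n) then show ?case unfolding uS vS by (intro primh holomorphic_intros p)
  qed
  have vh: "v n holomorphic_on D" for n
    by (cases n) (auto simp: v0 vS intro!: primh holomorphic_intros p uh)
  have du: "(u n has_field_derivative v n x) (at x)" if "x \<in> D" for n x
  proof (cases n)
    case 0 then show ?thesis by (auto simp: u0 v0 intro!: derivative_eq_intros)
  next
    case (Suc m) then show ?thesis using prim[OF vh] that by (simp add: uS)
  qed
  have dv: "(v (Suc n) has_field_derivative p x * u n x) (at x)" if "x \<in> D" for n x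
    unfolding vS by (intro prim holomorphic_intros p uh that)
  have ux0: "u (Suc n) x0 = 0" and vx0: "v (Suc n) x0 = 0" for n
    unfolding uS vS by (intro prim0 primh holomorphic_intros p uh)+
  \<comment> \<open>The two bounds feed each other: one integration leads from \<open>u n\<close> to
    \<open>v (Suc n)\<close>, a second one to \<open>u (Suc n)\<close>. Hence the exponent and the
    factorial advance by two per step.\<close>
  have bnd: "(\<forall>w\<in>closed_segment x0 y. norm (u n w) \<le> K * M ^ n * norm (w - x0) ^ (2 * n) / fact (2 * n)) \<and>
        (\<forall>w\<in>closed_segment x0 y. norm (v (Suc n) w) \<le> K * M ^ Suc n * norm (w - x0) ^ Suc (2 * n) / fact (Suc (2 * n)))"
    if y: "closed_segment x0 y \<subseteq> D" and M: "\<And>w. w \<in> closed_segment x0 y \<Longrightarrow> norm (p w) \<le> M"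
      and K: "\<And>w. w \<in> closed_segment x0 y \<Longrightarrow> norm (u 0 w) \<le> K" for K M y n
  proof (induction n)
    have M0: "0 \<le> M" by (rule order_trans[OF norm_ge_zero M[OF ends_in_segment(1)]])
    have sub: "closed_segment x0 w \<subseteq> closed_segment x0 y" if "w \<in> closed_segment x0 y" for w
      using that by (simp add: subset_closed_segment)
    have vb: "norm (v (Suc n) w) \<le> K * M ^ Suc n * norm (w - x0) ^ Suc (2 * n) / fact (Suc (2 * n))"
      if w: "w \<in> closed_segment x0 y"
      and ub: "\<forall>w\<in>closed_segment x0 y. norm (u n w) \<le> K * M ^ n * norm (w - x0) ^ (2 * n) / fact (2 * n)" for n w
    proof -
      have "norm (v (Suc n) w) \<le> (K * M ^ Suc n / fact (2 * n)) * norm (w - x0) ^ Suc (2 * n) / real (Suc (2 * n))"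
      proof (rule primitive_bound)
        fix s assume "s \<in> closed_segment x0 w"
        then have s: "s \<in> closed_segment x0 y" using sub w by blast
        then show "(v (Suc n) has_field_derivative p s * u n s) (at s)"
          using dv y by blast
        have "norm (p s * u n s) \<le> M * (K * M ^ n * norm (s - x0) ^ (2 * n) / fact (2 * n))"
          unfolding norm_mult using s ub M M0 by (intro mult_mono) auto
        then show "norm (p s * u n s) \<le> K * M ^ Suc n / fact (2 * n) * norm (s - x0) ^ (2 * n)"
          by (simp add: algebra_simps)
      qed (rule vx0)
      then show ?thesis by (simp add: fact_Suc mult.commute mult.left_commute del: of_nat_Suc)
    qed
    {
      case 0
      have "\<forall>w\<in>closed_segment x0 y. norm (u 0 w) \<le> K * M ^ 0 * norm (w - x0) ^ (2 * 0) / fact (2 * 0)"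
        using K by simp
      with vb[of _ 0] show ?case by blast
    next
      case (Suc n)
      have ub: "norm (u (Suc n) w) \<le> K * M ^ Suc n * norm (w - x0) ^ (2 * Suc n) / fact (2 * Suc n)"
        if w: "w \<in> closed_segment x0 y" for w
      proof -
        have "norm (u (Suc n) w) \<le> (K * M ^ Suc n / fact (Suc (2 * n))) * norm (w - x0) ^ Suc (Suc (2 * n)) / real (Suc (Suc (2 * n)))"
        proof (rule primitive_bound)
          fix s assume "s \<in> closed_segment x0 w"
          then have s: "s \<in> closed_segment x0 y" using sub w by blast
          then show "(u (Suc n) has_field_derivative v (Suc n) s) (at s)"
            using du y by blast
          show "norm (v (Suc n) s) \<le> K * M ^ Suc n / fact (Suc (2 * n)) * norm (s - x0) ^ Suc (2 * n)"
            using Suc s by simp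
        qed (rule ux0)
        then show ?thesis by (simp add: fact_Suc mult.commute mult.left_commute del: of_nat_Suc)
      qed
      with vb[of _ "Suc n"] show ?case by blast
    }
  qed
  have local: "\<exists>d h. 0 < d \<and> summable h \<and> (\<forall>y\<in>ball x d. \<forall>n. norm (c ^ n * u n y) \<le> h n)"
    "\<exists>d h. 0 < d \<and> summable h \<and> (\<forall>y\<in>ball x d. \<forall>n. norm (c ^ n * v n y) \<le> h n)" if x: "x \<in> D" for x c
  proof -
    obtain d M where d: "0 < d" "0 \<le> M" "\<And>y. y \<in> ball x d \<Longrightarrow> closed_segment x0 y \<subseteq> D"
      and M: "\<And>y w. y \<in> ball x d \<Longrightarrow> w \<in> closed_segment x0 y \<Longrightarrow> norm (p w) \<le> M"
      using segment_neighbourhood_bound[OF D(1) D(3)[OF x]] p holomorphic_on_imp_continuous_on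
      by metis
    define L where "L = norm (x - x0) + d"
    define K where "K = norm A + norm B * L"
    have L: "norm (w - x0) \<le> L" if "y \<in> ball x d" "w \<in> closed_segment x0 y" for y w
    proof -
      have "norm (w - x0) \<le> norm (y - x0)"
        using segment_bound[OF that(2)] by simp
      also have "\<dots> \<le> norm (y - x) + norm (x - x0)"
        by (metis diff_add_cancel diff_diff_eq2 norm_triangle_ineq)
      finally show ?thesis using that(1) by (simp add: L_def dist_norm norm_minus_commute)
    qed
    have L0: "0 < L" using d by (simp add: L_def add_nonneg_pos)
    then have K0: "0 \<le> K" by (simp add: K_def)
    have Kb: "norm (u 0 w) \<le> K" if "y \<in> ball x d" "w \<in> closed_segment x0 y" for y w
    proof -
      have "norm (u 0 w) \<le> norm A + norm B * norm (w - x0)"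
        unfolding u0 by (metis norm_mult norm_triangle_ineq)
      also have "\<dots> \<le> K" unfolding K_def by (intro add_left_mono mult_left_mono L[OF that]) auto
      finally show ?thesis .
    qed
    define q where "q = norm c * M * L ^ 2"
    have sq: "(L\<^sup>2) ^ n = (L ^ n)\<^sup>2" for n
      by (metis power_mult mult.commute)
    have ub: "norm (c ^ n * u n y) \<le> K * (inverse (fact n) * q ^ n)" if y: "y \<in> ball x d" for y n
    proof -
      have "norm (u n y) \<le> K * M ^ n * norm (y - x0) ^ (2 * n) / fact (2 * n)"
        using bnd[OF d(3)[OF y] M[OF y] Kb[OF y]] by auto
      \<comment> \<open>Weakening \<open>fact (2 * n)\<close> to \<open>fact n\<close> is harmless
        and makes the exponential series at \<open>q\<close> the majorant.\<close>
      also have "\<dots> \<le> K * M ^ n * L ^ (2 * n) / fact n"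
        using d(2) K0 L0 L[OF y] by (intro frac_le mult_left_mono power_mono fact_mono) auto
      finally have "norm (c ^ n) * norm (u n y) \<le> norm (c ^ n) * (K * M ^ n * L ^ (2 * n) / fact n)"
        by (intro mult_left_mono) auto
      then show ?thesis
        by (simp add: q_def sq norm_mult norm_power power_mult power_mult_distrib field_simps)
    qed
    have vb: "norm (c ^ Suc n * v (Suc n) y) \<le> norm c * K * M * L * (inverse (fact n) * q ^ n)"
      if y: "y \<in> ball x d" for y n
    proof -
      have "norm (v (Suc n) y) \<le> K * M ^ Suc n * norm (y - x0) ^ Suc (2 * n) / fact (Suc (2 * n))"
        using bnd[OF d(3)[OF y] M[OF y] Kb[OF y]] by auto
      also have "\<dots> \<le> K * M ^ Suc n * L ^ Suc (2 * n) / fact n"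
        using d(2) K0 L0 L[OF y] by (intro frac_le mult_left_mono power_mono fact_mono mult_nonneg_nonneg) auto
      finally have "norm (c ^ Suc n) * norm (v (Suc n) y) \<le> norm (c ^ Suc n) * (K * M ^ Suc n * L ^ Suc (2 * n) / fact n)"
        by (intro mult_left_mono) auto
      then show ?thesis
        by (simp add: q_def sq norm_mult norm_power power_mult power_mult_distrib field_simps)
    qed
    have s: "summable (\<lambda>n. K' * (inverse (fact n) * q ^ n))" for K'
      by (intro summable_mult summable_exp)
    show "\<exists>d h. 0 < d \<and> summable h \<and> (\<forall>y\<in>ball x d. \<forall>n. norm (c ^ n * u n y) \<le> h n)"
      using d(1) s ub by blast
    define h where "h = (\<lambda>n. case n of 0 \<Rightarrow> norm B | Suc n \<Rightarrow> norm c * K * M * L * (inverse (fact n) * q ^ n))"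
    have "summable h"
      using s[of "norm c * K * M * L"] by (subst summable_Suc_iff[symmetric]) (simp only: h_def nat.case)
    moreover have "norm (c ^ n * v n y) \<le> h n" if "y \<in> ball x d" for n y
      using vb[OF that] by (cases n) (auto simp: h_def v0)
    ultimately show "\<exists>d h. 0 < d \<and> summable h \<and> (\<forall>y\<in>ball x d. \<forall>n. norm (c ^ n * v n y) \<le> h n)"
      using d(1) by blast
  qed
  define U where "U = (\<lambda>c x. \<Sum>n. c ^ n * u n x)"
  define U' where "U' = (\<lambda>c x. \<Sum>n. c ^ n * v n x)"
  define v' where "v' = (\<lambda>n x. case n of 0 \<Rightarrow> 0 | Suc m \<Rightarrow> p x * u m x)"
  have dv': "(v n has_field_derivative v' n x) (at x)" if "x \<in> D" for n x
    using dv[OF that] by (cases n) (auto simp: v0 v'_def)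
  have su: "(\<lambda>n. c ^ n * u n x) sums U c x" and sv: "(\<lambda>n. c ^ n * v n x) sums U' c x"
    if "x \<in> D" for c x
    unfolding U_def U'_def using local[OF that, of c] centre_in_ball
    by (meson summable_comparison_test' summable_sums)+
  have ev: "\<exists>d h. 0 < d \<and> summable h \<and> (\<forall>\<^sub>F n in sequentially. \<forall>y\<in>ball x d \<inter> D. norm (f n y) \<le> h n)"
    if "\<exists>d h. 0 < d \<and> summable h \<and> (\<forall>y\<in>ball x d. \<forall>n. norm (f n y) \<le> h n)"
    for x :: complex and f :: "nat \<Rightarrow> complex \<Rightarrow> complex"
    using that by (auto intro!: always_eventually)
  have "(U c has_field_derivative U' c x) (at x) \<and> (U' c has_field_derivative c * p x * U c x) (at x)"
    if x: "x \<in> D" for c x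
  proof
    have "\<exists>g g'. \<forall>x\<in>D. (\<lambda>n. c ^ n * u n x) sums g x \<and> (\<lambda>n. c ^ n * v n x) sums g' x \<and> (g has_field_derivative g' x) (at x)"
      by (intro series_and_derivative_comparison_local[OF D(1)] DERIV_cmult du ev local)
    then obtain g g' where g: "\<forall>x\<in>D. (\<lambda>n. c ^ n * u n x) sums g x \<and> (\<lambda>n. c ^ n * v n x) sums g' x \<and> (g has_field_derivative g' x) (at x)"
      by blast
    then have "g' x = U' c x" "(g has_field_derivative g' x) (at x)" "\<And>x. x \<in> D \<Longrightarrow> g x = U c x"
      using su sv x by (blast intro: sums_unique2)+
    then show "(U c has_field_derivative U' c x) (at x)"
      using has_field_derivative_transform_within_open[OF _ D(1) x, of g "g' x" "U c"] by simp
    have "\<exists>g g'. \<forall>x\<in>D. (\<lambda>n. c ^ n * v n x) sums g x \<and> (\<lambda>n. c ^ n * v' n x) sums g' x \<and> (g has_field_derivative g' x) (at x)"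
      by (intro series_and_derivative_comparison_local[OF D(1)] DERIV_cmult dv' ev local)
    then obtain g g' where g: "\<forall>x\<in>D. (\<lambda>n. c ^ n * v n x) sums g x \<and> (\<lambda>n. c ^ n * v' n x) sums g' x \<and> (g has_field_derivative g' x) (at x)"
      by blast
    \<comment> \<open>The index shift produces the factor c: the derivative of
      \<open>v (Suc n)\<close> involves \<open>u n\<close>.\<close>
    have "(\<lambda>n. c ^ Suc n * v' (Suc n) x) sums (c * p x * U c x)"
      using sums_mult[OF su[OF x], of "c * p x" c] by (simp add: v'_def mult_ac)
    then have "(\<lambda>n. c ^ n * v' n x) sums (c * p x * U c x)"
      by (subst (asm) sums_Suc_iff) (simp add: v'_def)
    then have "g' x = c * p x * U c x" "(g has_field_derivative g' x) (at x)" "\<And>x. x \<in> D \<Longrightarrow> g x = U' c x"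
      using g sv x by (blast intro: sums_unique2)+
    then show "(U' c has_field_derivative c * p x * U c x) (at x)"
      using has_field_derivative_transform_within_open[OF _ D(1) x, of g "g' x" "U' c"] by simp
  qed
  moreover have "U c x0 = A" "U' c x0 = B" for c
  proof -
    have "(\<lambda>n. c ^ n * u n x0) = (\<lambda>n. if n = 0 then A else 0)"
      "(\<lambda>n. c ^ n * v n x0) = (\<lambda>n. if n = 0 then B else 0)"
      using ux0 vx0 u0 v0 by (auto simp: fun_eq_iff gr0_conv_Suc)
    then have "(\<lambda>n. c ^ n * u n x0) sums A" "(\<lambda>n. c ^ n * v n x0) sums B"
      using sums_single[of 0 "\<lambda>_. A"] sums_single[of 0 "\<lambda>_. B"] by simp_all
    then show "U c x0 = A" "U' c x0 = B"
      using su[OF D(2), of c] sv[OF D(2), of c] by (blast intro: sums_unique2)+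
  qed
  moreover have "(\<lambda>c. U c x) holomorphic_on UNIV" "(\<lambda>c. U' c x) holomorphic_on UNIV" if "x \<in> D" for x
  proof -
    have "(\<lambda>c. U c x) holomorphic_on ball 0 r" for r
      using su[OF that] by (auto intro!: power_series_holomorphic[where a = "\<lambda>n. u n x"] simp: mult.commute)
    moreover have "(\<lambda>c. U' c x) holomorphic_on ball 0 r" for r
      using sv[OF that] by (auto intro!: power_series_holomorphic[where a = "\<lambda>n. v n x"] simp: mult.commute)
    moreover have "f holomorphic_on UNIV" if "\<And>r. f holomorphic_on ball 0 r" for f :: "complex \<Rightarrow> complex"
    proof -
      have "f field_differentiable at c" for c
        using that[of "norm c + 1"]
        by (rule holomorphic_on_imp_differentiable_at) auto
      then show ?thesis
        by (simp add: holomorphic_on_def)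
    qed
    ultimately show "(\<lambda>c. U c x) holomorphic_on UNIV" "(\<lambda>c. U' c x) holomorphic_on UNIV"
      by blast+
  qed
  ultimately show thesis by (intro that[of U U']) auto
qed

lemma wronskian_constant:
  fixes f g q :: "complex \<Rightarrow> complex"
  assumes "open D" "connected D" "x \<in> D" "y \<in> D"
    and "\<And>x. x \<in> D \<Longrightarrow> (f has_field_derivative f' x) (at x)"
    and "\<And>x. x \<in> D \<Longrightarrow> (f' has_field_derivative q x * f x) (at x)"
    and "\<And>x. x \<in> D \<Longrightarrow> (g has_field_derivative g' x) (at x)"
    and "\<And>x. x \<in> D \<Longrightarrow> (g' has_field_derivative q x * g x) (at x)"
  shows "f x * g' x - f' x * g x = f y * g' y - f' y * g y"
proof -
  have "((\<lambda>x. f x * g' x - f' x * g x) has_field_derivative 0) (at x)" if "x \<in> D" for x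
    by (auto intro!: derivative_eq_intros assms(5-8)[OF that] simp: algebra_simps)
  then show ?thesis
    using has_field_derivative_0_imp_constant_on[of D "\<lambda>x. f x * g' x - f' x * g x"] assms(1-4)
    by (auto simp: constant_on_def)
qed

text \<open>Cramer's rule: if W(u,v) = 1, then f = W(f,v) u - W(f,u) v. These Wronskians are
  constant and may be evaluated at \<open>x0\<close>. The identity takes the place of a uniqueness
  theorem for the initial value problem.\<close>

lemma solution_in_fundamental_system:
  fixes f u v q :: "complex \<Rightarrow> complex"
  assumes D: "open D" "connected D" "x0 \<in> D" "x \<in> D"
    and f: "\<And>x. x \<in> D \<Longrightarrow> (f has_field_derivative f' x) (at x)"
      "\<And>x. x \<in> D \<Longrightarrow> (f' has_field_derivative q x * f x) (at x)"
    and u: "\<And>x. x \<in> D \<Longrightarrow> (u has_field_derivative u' x) (at x)"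
      "\<And>x. x \<in> D \<Longrightarrow> (u' has_field_derivative q x * u x) (at x)"
    and v: "\<And>x. x \<in> D \<Longrightarrow> (v has_field_derivative v' x) (at x)"
      "\<And>x. x \<in> D \<Longrightarrow> (v' has_field_derivative q x * v x) (at x)"
    and W: "\<And>x. x \<in> D \<Longrightarrow> u x * v' x - u' x * v x = 1"
  shows "f x = (f x0 * v' x0 - f' x0 * v x0) * u x + (f' x0 * u x0 - f x0 * u' x0) * v x"
proof -
  have "f x = f x * (u x * v' x - u' x * v x)" using W[OF D(4)] by simp
  also have "\<dots> = (f x * v' x - f' x * v x) * u x - (f x * u' x - f' x * u x) * v x"
    by (simp add: algebra_simps)
  also have "\<dots> = (f x0 * v' x0 - f' x0 * v x0) * u x - (f x0 * u' x0 - f' x0 * u x0) * v x"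
    using wronskian_constant[OF D(1,2,4,3) f v] wronskian_constant[OF D(1,2,4,3) f u] by simp
  finally show ?thesis by (simp add: algebra_simps)
qed

subsection \<open>The hypergeometric series and its parameter\<close>

text \<open>The half-plane contains both b = a and b = -a-1 when \<bar>Re a\<bar> < 1. Of the zeros
  of the Pochhammer symbols of 2b+3 only b = -3/2 lies in it; the next one is b = -2.\<close>

definition param_dom :: "complex set" where
  "param_dom = {b. -2 < Re b \<and> b \<noteq> -3/2}"

text \<open>
  The coefficients of \<open>F(b,b+1;2b+2;x)\<close> with the common factor \<open>b+1\<close> of the Pochhammer symbols
  cancelled, so that they stay analytic at \<open>b = -1\<close>.
\<close>

definition hyp_coeff :: "complex \<Rightarrow> nat \<Rightarrow> complex" where
  "hyp_coeff b n = (if n = 0 then 1 else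
     pochhammer b n * pochhammer (b + 2) (n - 1) / (2 * pochhammer (2 * b + 3) (n - 1) * fact n))"

definition hyp_fps :: "complex \<Rightarrow> complex fps" where
  "hyp_fps b = Abs_fps (hyp_coeff b)"

lemma open_param_dom: "open param_dom"
proof -
  have "open ({b. Re b > -2} - {-3/2})"
    by (intro open_Diff open_halfspace_Re_gt closed_singleton)
  also have "{b. Re b > -2} - {-3/2} = param_dom" by (auto simp: param_dom_def)
  finally show ?thesis .
qed

lemma pochhammer_param_dom_nonzero:
  assumes "b \<in> param_dom"
  shows "pochhammer (2 * b + 3) n \<noteq> 0"
proof
  assume "pochhammer (2 * b + 3) n = 0"
  then obtain k :: nat where k: "2 * b + 3 = - of_nat k" by (auto simp: pochhammer_eq_0_iff)
  then have "Re (2 * b + 3) = Re (- of_nat k)" by (rule arg_cong)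
  with assms have "k = 0" by (auto simp: param_dom_def)
  with k have "2 * (b + 3/2) = 0" by simp
  then have "b + 3/2 = 0" by (simp only: mult_eq_0_iff) simp
  then have "b = -3/2" by (metis add_eq_0_iff2 divide_minus_left)
  with assms show False by (simp add: param_dom_def)
qed

text \<open>With denominators cleared the recurrence survives at b = -1, where both sides vanish for
  n = 0. The growth estimate and the differential equation both rest on it.\<close>

lemma hyp_coeff_rec:
  assumes "b \<in> param_dom"
  shows "of_nat (Suc n) * (2 * b + 2 + of_nat n) * hyp_coeff b (Suc n) = (b + of_nat n) * (b + 1 + of_nat n) * hyp_coeff b n"
proof (cases n)
  case 0
  then show ?thesis by (simp add: hyp_coeff_def field_simps)
next
  case (Suc m)
  have nz: "pochhammer (2 * b + 3) (Suc m) \<noteq> 0" "pochhammer (2 * b + 3) m \<noteq> 0"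
    using pochhammer_param_dom_nonzero[OF assms] by auto
  then have nz': "2 * b + 3 + of_nat m \<noteq> 0" by (auto simp: pochhammer_Suc)
  have "(of_nat (Suc n) :: complex) \<noteq> 0" by (simp del: of_nat_Suc)
  then show ?thesis
    using nz(2) nz' unfolding Suc hyp_coeff_def
    by (simp add: pochhammer_Suc fact_Suc divide_simps del: of_nat_Suc) (simp add: algebra_simps)
qed

lemma hyp_coeff_eq_hypergeo:
  assumes "b \<in> param_dom" "b \<noteq> -1"
  shows "fps_hypergeo [b, b + 1] [2 * b + 2] 1 = hyp_fps b"
proof (rule fps_ext)
  fix n
  have "b + 1 \<noteq> 0" using assms(2) by (metis add_eq_0_iff2)
  moreover have "2 * b + 2 = 2 * (b + 1)" by (simp add: algebra_simps)
  moreover have "pochhammer (2 * b + 2) (Suc m) = (2 * b + 2) * pochhammer (2 * b + 3) m" for m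
    by (simp add: pochhammer_rec add.assoc)
  moreover have "pochhammer (b + 1) (Suc m) = (b + 1) * pochhammer (b + 2) m" for m
    by (simp add: pochhammer_rec add.assoc)
  ultimately show "fps_nth (fps_hypergeo [b, b + 1] [2 * b + 2] 1) n = fps_nth (hyp_fps b) n"
    by (cases n) (simp_all add: hyp_fps_def hyp_coeff_def del: fact_Suc distrib_left_numeral)
qed

lemma holomorphic_hyp_coeff: "(\<lambda>b. hyp_coeff b n) holomorphic_on param_dom"
  unfolding hyp_coeff_def
  by (cases "n = 0") (auto intro!: holomorphic_intros simp: pochhammer_param_dom_nonzero)

text \<open>By the recurrence, the growth factor between consecutive coefficients is bounded,
  uniformly on the compact set, by a quantity tending to 1. Beyond some \<open>N\<close> a step
  costs at most the factor \<open>q\<close>; the finitely many earlier coefficients are bounded by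
  continuity and go into \<open>C\<close>.\<close>

lemma hyp_coeff_growth:
  assumes K: "compact K" "K \<subseteq> param_dom" and q: "1 < q"
  obtains C where "\<And>b n. b \<in> K \<Longrightarrow> norm (hyp_coeff b n) \<le> C * q ^ n"
proof -
  obtain R where R: "0 < R" "\<And>b. b \<in> K \<Longrightarrow> norm b \<le> R"
    using compact_imp_bounded[OF K(1)] by (auto simp: bounded_pos)
  have "((\<lambda>n. (real n + R) * (real n + 1 + R) / ((real n + 1) * (real n - 2 * R))) \<longlongrightarrow> 1) at_top"
    by real_asymp
  then have "eventually (\<lambda>n. (real n + R) * (real n + 1 + R) / ((real n + 1) * (real n - 2 * R)) < q) at_top"
    using q by (rule order_tendstoD)
  moreover have "eventually (\<lambda>n. 0 < real n - 2 * R) at_top" by real_asymp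
  ultimately have "eventually (\<lambda>n. (real n + R) * (real n + 1 + R) \<le> q * ((real n + 1) * (real n - 2 * R)) \<and> 0 < real n - 2 * R) at_top"
    by eventually_elim (simp add: divide_simps mult_ac)
  then obtain N where N: "\<And>n. n \<ge> N \<Longrightarrow> (real n + R) * (real n + 1 + R) \<le> q * ((real n + 1) * (real n - 2 * R))"
    "\<And>n. n \<ge> N \<Longrightarrow> 0 < real n - 2 * R"
    by (auto simp: eventually_at_top_linorder)
  have step: "norm (hyp_coeff b (Suc n)) \<le> q * norm (hyp_coeff b n)" if b: "b \<in> K" and n: "n \<ge> N" for b n
  proof -
    have "real n - 2 * R \<le> norm (2 * b + 2 + of_nat n)"
    proof -
      have "norm (of_nat (n + 2) :: complex) \<le> norm (2 * b + 2 + of_nat n) + norm (2 * b)"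
        using norm_triangle_ineq4[of "2 * b + 2 + of_nat n" "2 * b"] by (simp add: algebra_simps)
      moreover have "norm (of_nat (n + 2) :: complex) = real n + 2" by (metis norm_of_nat of_nat_add of_nat_numeral)
      ultimately show ?thesis using R(2)[OF b] by (simp add: norm_mult)
    qed
    then have "(real n + 1) * (real n - 2 * R) * norm (hyp_coeff b (Suc n)) \<le>
        (real n + 1) * norm (2 * b + 2 + of_nat n) * norm (hyp_coeff b (Suc n))"
      by (intro mult_right_mono mult_left_mono) auto
    also have "\<dots> = norm ((b + of_nat n) * (b + 1 + of_nat n) * hyp_coeff b n)"
      using arg_cong[OF hyp_coeff_rec[of b n, OF subsetD[OF K(2) b]], of norm]
      by (simp add: norm_mult del: of_nat_Suc) (simp add: add.commute)
    also have "\<dots> \<le> (real n + R) * (real n + 1 + R) * norm (hyp_coeff b n)"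
    proof -
      have "norm (b + of_nat n) \<le> real n + R"
        using norm_triangle_ineq[of b "of_nat n"] R(2)[OF b] by simp
      moreover have "norm (b + 1 + of_nat n) \<le> real n + 1 + R"
      proof -
        have "b + 1 + of_nat n = b + of_nat (Suc n)" by simp
        then show ?thesis
          using norm_triangle_ineq[of b "of_nat (Suc n)"] R(2)[OF b] by (simp only: norm_of_nat)
      qed
      ultimately show ?thesis using R(1) unfolding norm_mult by (intro mult_right_mono mult_mono) auto
    qed
    also have "\<dots> \<le> q * ((real n + 1) * (real n - 2 * R)) * norm (hyp_coeff b n)"
      using N(1)[OF n] by (intro mult_right_mono) auto
    finally have "((real n + 1) * (real n - 2 * R)) * norm (hyp_coeff b (Suc n)) \<le>
       ((real n + 1) * (real n - 2 * R)) * (q * norm (hyp_coeff b n))" by (simp add: mult_ac)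
    moreover have "0 < (real n + 1) * (real n - 2 * R)" using N(2)[OF n] by simp
    ultimately show ?thesis by (rule mult_left_le_imp_le)
  qed
  have "\<exists>B. \<forall>b\<in>K. norm (hyp_coeff b n) \<le> B" for n
  proof -
    have "continuous_on K (\<lambda>b. hyp_coeff b n)"
      using holomorphic_hyp_coeff K(2) by (meson continuous_on_subset holomorphic_on_imp_continuous_on)
    then have "bounded ((\<lambda>b. hyp_coeff b n) ` K)"
      using K(1) compact_continuous_image compact_imp_bounded by blast
    then show ?thesis by (auto simp: bounded_iff)
  qed
  then obtain B where B: "\<And>n b. b \<in> K \<Longrightarrow> norm (hyp_coeff b n) \<le> B n" by metis
  define C where "C = (\<Sum>k\<le>N. \<bar>B k\<bar>)"
  have "norm (hyp_coeff b n) \<le> C * q ^ n" if b: "b \<in> K" for b n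
  proof (induction n)
    have le: "norm (hyp_coeff b n) \<le> C * q ^ n" if "n \<le> N" for n
    proof -
      have "norm (hyp_coeff b n) \<le> \<bar>B n\<bar>" using B[OF b, of n] by linarith
      also have "\<dots> \<le> C" unfolding C_def using that by (intro member_le_sum) auto
      also have "\<dots> = C * 1" by simp
      also have "\<dots> \<le> C * q ^ n" using q by (intro mult_left_mono) (auto simp: C_def sum_nonneg)
      finally show ?thesis .
    qed
    {
      case 0 show ?case by (rule le) simp
    next
      case (Suc n)
      show ?case
      proof (cases "Suc n \<le> N")
        case True then show ?thesis by (rule le)
      next
        case False
        then have "norm (hyp_coeff b (Suc n)) \<le> q * norm (hyp_coeff b n)" using step[OF b] by simp
        also have "\<dots> \<le> q * (C * q ^ n)" using Suc q by (intro mult_left_mono) auto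
        finally show ?thesis by (simp add: mult_ac)
      qed
    }
  qed
  then show thesis by (rule that)
qed

lemma conv_radius_hyp_fps:
  assumes "b \<in> param_dom"
  shows "1 \<le> fps_conv_radius (hyp_fps b)"
  unfolding fps_conv_radius_def
proof (rule conv_radius_geI_ex)
  fix r :: real assume r: "0 < r" "ereal r < 1"
  \<comment> \<open>The mean of 1 and 1/r, so that 1 < q and q r < 1.\<close>
  define q where "q = (1 + 1 / r) / 2"
  have q: "1 < q" "q * r < 1" using r by (auto simp: q_def field_simps)
  obtain C where C: "\<And>n. norm (hyp_coeff b n) \<le> C * q ^ n"
    by (rule hyp_coeff_growth[of "{b}" q]) (use assms q in auto)
  have "summable (\<lambda>n. C * (q * r) ^ n)"
    using q r by (intro summable_mult summable_geometric) auto
  then have "summable (\<lambda>n. hyp_coeff b n * of_real r ^ n)"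
  proof (rule summable_comparison_test'[where N = 0])
    fix n
    have "norm (hyp_coeff b n) * r ^ n \<le> C * q ^ n * r ^ n"
      using C r by (intro mult_right_mono) auto
    then show "norm (hyp_coeff b n * of_real r ^ n) \<le> C * (q * r) ^ n"
      using r by (simp add: norm_mult norm_power power_mult_distrib mult.assoc)
  qed
  then show "\<exists>z. norm z = r \<and> summable (\<lambda>n. fps_nth (hyp_fps b) n * z ^ n)"
    using r by (intro exI[of _ "of_real r"]) (auto simp: hyp_fps_def)
qed

text \<open>At b = -1 this is the limit of F(b,b+1;2b+2;x) as b tends to -1. That value of b is the
  parameter of \<open>s_inf\<close> at a = 0.\<close>

definition hyp_fun :: "complex \<Rightarrow> complex \<Rightarrow> complex" where
  "hyp_fun b = eval_fps (hyp_fps b)"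

definition hyp_fun' :: "complex \<Rightarrow> complex \<Rightarrow> complex" where
  "hyp_fun' b = eval_fps (fps_deriv (hyp_fps b))"

definition hyp_fun'' :: "complex \<Rightarrow> complex \<Rightarrow> complex" where
  "hyp_fun'' b = eval_fps (fps_deriv (fps_deriv (hyp_fps b)))"

lemma hyp_radius:
  assumes "b \<in> param_dom" "norm x < 1"
  shows "ereal (norm x) < fps_conv_radius (hyp_fps b)"
    "ereal (norm x) < fps_conv_radius (fps_deriv (hyp_fps b))"
    "ereal (norm x) < fps_conv_radius (fps_deriv (fps_deriv (hyp_fps b)))"
proof -
  have *: "ereal (norm x) < 1" using assms(2) by simp
  show 1: "ereal (norm x) < fps_conv_radius (hyp_fps b)"
    using conv_radius_hyp_fps[OF assms(1)] * by (rule order.strict_trans2[rotated])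
  show 2: "ereal (norm x) < fps_conv_radius (fps_deriv (hyp_fps b))"
    using fps_conv_radius_deriv 1 by (rule order.strict_trans2[rotated])
  show "ereal (norm x) < fps_conv_radius (fps_deriv (fps_deriv (hyp_fps b)))"
    using fps_conv_radius_deriv 2 by (rule order.strict_trans2[rotated])
qed

lemma has_field_derivative_hyp_fun:
  assumes "b \<in> param_dom" "norm x < 1"
  shows "(hyp_fun b has_field_derivative hyp_fun' b x) (at x)"
    "(hyp_fun' b has_field_derivative hyp_fun'' b x) (at x)"
  unfolding hyp_fun_def hyp_fun'_def hyp_fun''_def
  by (intro has_field_derivative_eval_fps hyp_radius assms)+

text \<open>Here the lower parameter exceeds the sum of the upper ones by exactly 1, so the usual
  first-order coefficient of Gauss' equation factors as (2b+2)(1-x). The common factor 1-x is what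
  makes the first-order term disappear in the coordinate \<eta>.\<close>

lemma hyp_fps_ode:
  assumes "b \<in> param_dom"
  shows "fps_X * ((1 - fps_X) * fps_deriv (fps_deriv (hyp_fps b)))
    + fps_const (2 * b + 2) * ((1 - fps_X) * fps_deriv (hyp_fps b)) = fps_const (b * (b + 1)) * hyp_fps b"
    (is "?L = ?R")
proof (rule fps_ext)
  fix n
  show "fps_nth ?L n = fps_nth ?R n"
  proof (cases n)
    case 0
    then show ?thesis using hyp_coeff_rec[OF assms, of 0] by (simp add: hyp_fps_def algebra_simps)
  next
    case (Suc m)
    show ?thesis using hyp_coeff_rec[OF assms, of "Suc m"] unfolding Suc
      by (cases m) (simp_all add: hyp_fps_def algebra_simps)
  qed
qed

lemma hyp_fun_ode:
  assumes "b \<in> param_dom" "norm x < 1"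
  shows "x * ((1 - x) * hyp_fun'' b x) + (2 * b + 2) * ((1 - x) * hyp_fun' b x) = b * (b + 1) * hyp_fun b x"
proof -
  note r = hyp_radius[OF assms]
  have rx: "ereal (norm x) < fps_conv_radius (1 - fps_X :: complex fps)"
    using fps_conv_radius_diff[of 1 "fps_X :: complex fps"] by simp
  have r1: "ereal (norm x) < fps_conv_radius ((1 - fps_X) * fps_deriv (hyp_fps b))"
    "ereal (norm x) < fps_conv_radius ((1 - fps_X) * fps_deriv (fps_deriv (hyp_fps b)))"
    using fps_conv_radius_mult rx r by (meson min_less_iff_conj order.strict_trans2)+
  have r2: "ereal (norm x) < fps_conv_radius (fps_const (2 * b + 2) * ((1 - fps_X) * fps_deriv (hyp_fps b)))"
    "ereal (norm x) < fps_conv_radius (fps_X * ((1 - fps_X) * fps_deriv (fps_deriv (hyp_fps b))))"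
    using fps_conv_radius_mult r1 by (metis fps_conv_radius_const fps_conv_radius_fps_X ereal_infty_less(1) ereal_less_PInfty less_ereal.simps(2) min_less_iff_conj order.strict_trans2)+
  have "eval_fps (fps_X * ((1 - fps_X) * fps_deriv (fps_deriv (hyp_fps b)))
    + fps_const (2 * b + 2) * ((1 - fps_X) * fps_deriv (hyp_fps b))) x = eval_fps (fps_const (b * (b + 1)) * hyp_fps b) x"
    using hyp_fps_ode[OF assms(1)] by (rule arg_cong[where f = "\<lambda>f. eval_fps f x"])
  then show ?thesis
    using r r1 r2 rx by (simp add: eval_fps_add eval_fps_mult eval_fps_diff hyp_fun_def hyp_fun'_def hyp_fun''_def)
qed

text \<open>The Wronskian of two solutions, in the coordinate \<open>x = 1/\<eta>\<close>.\<close>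

lemma hyp_fun_wronskian:
  assumes a: "a \<in> param_dom" "- a - 1 \<in> param_dom" and x: "norm x < 1"
  defines "b \<equiv> - a - 1"
  shows "(a - b) * hyp_fun a x * hyp_fun b x + x * (hyp_fun b x * hyp_fun' a x - hyp_fun a x * hyp_fun' b x) = 2 * a + 1"
proof -
  define w where "w = (\<lambda>x. (a - b) * hyp_fun a x * hyp_fun b x + x * (hyp_fun b x * hyp_fun' a x - hyp_fun a x * hyp_fun' b x))"
  have b: "b \<in> param_dom" using a(2) by (simp add: b_def)
  have "(w has_field_derivative 0) (at x)" if x: "x \<in> ball 0 1" for x
  proof -
    have x1: "norm x < 1" "1 - x \<noteq> 0" using x by auto
    define A A' A'' B B' B'' where "A = hyp_fun a x" "A' = hyp_fun' a x" "A'' = hyp_fun'' a x"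
      "B = hyp_fun b x" "B' = hyp_fun' b x" "B'' = hyp_fun'' b x"
    note defs = this
    have "(w has_field_derivative (a - b) * (A' * B + A * B') + (B * A' - A * B') + x * (B * A'' - A * B'')) (at x)"
      unfolding w_def defs
      by (rule derivative_eq_intros has_field_derivative_hyp_fun a(1) b x1(1) refl)+ (simp add: algebra_simps)
    moreover have "(a - b) * (A' * B + A * B') + (B * A' - A * B') + x * (B * A'' - A * B'') = 0"
    proof -
      have 1: "x * ((1 - x) * A'') + (2 * a + 2) * ((1 - x) * A') = a * (a + 1) * A"
        using hyp_fun_ode[OF a(1) x1(1)] by (simp add: defs)
      have 2: "x * ((1 - x) * B'') + (2 * b + 2) * ((1 - x) * B') = b * (b + 1) * B"
        using hyp_fun_ode[OF b x1(1)] by (simp add: defs)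
      \<comment> \<open>Both equations carry the factor 1-x, so the identity is derived after
        multiplying by it. The right-hand sides cancel because b(b+1) = a(a+1).\<close>
      have "(1 - x) * ((a - b) * (A' * B + A * B') + (B * A' - A * B') + x * (B * A'' - A * B'')) = 0"
        using 1 2 unfolding b_def by algebra
      then show ?thesis using x1(2) by simp
    qed
    ultimately show ?thesis by simp
  qed
  then have "w constant_on ball 0 1"
    by (intro has_field_derivative_0_imp_constant_on) auto
  then have "w x = w 0" using x by (auto simp: constant_on_def)
  also have "w 0 = 2 * a + 1"
    by (simp add: w_def b_def hyp_fun_def eval_fps_at_0 hyp_fps_def hyp_coeff_def)
  finally show ?thesis by (simp add: w_def)
qed

lemma holomorphic_series_in_parameter:
  fixes t :: "complex \<Rightarrow> nat \<Rightarrow> complex"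
  assumes "open B" "\<And>n. (\<lambda>b. t b n) holomorphic_on B"
    and growth: "\<And>K. compact K \<Longrightarrow> K \<subseteq> B \<Longrightarrow> \<exists>C. \<forall>b\<in>K. \<forall>n. norm (t b n) \<le> C * q ^ n"
    and x: "0 < q" "q * norm x < 1"
  shows "(\<lambda>b. \<Sum>n. t b n * x ^ n) holomorphic_on B"
proof -
  have "\<exists>g g'. \<forall>b\<in>B. (\<lambda>n. t b n * x ^ n) sums g b \<and> (\<lambda>n. deriv (\<lambda>b. t b n * x ^ n) b) sums g' b \<and> (g has_field_derivative g' b) (at b)"
  proof (rule series_and_derivative_comparison_local[OF assms(1)])
    fix n b assume b: "b \<in> B"
    have "(\<lambda>b. t b n * x ^ n) holomorphic_on B" by (intro holomorphic_intros assms)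
    then show "((\<lambda>b. t b n * x ^ n) has_field_derivative deriv (\<lambda>b. t b n * x ^ n) b) (at b)"
      using assms(1) b by (rule holomorphic_derivI)
  next
    fix b assume "b \<in> B"
    then obtain d where d: "0 < d" "cball b d \<subseteq> B"
      using assms(1) open_contains_cball by blast
    then obtain C where C: "\<And>b' n. b' \<in> cball b d \<Longrightarrow> norm (t b' n) \<le> C * q ^ n"
      using growth[OF compact_cball d(2)] by blast
    have "norm (t y n * x ^ n) \<le> C * (q * norm x) ^ n" if "y \<in> ball b d" for y n
    proof -
      have "norm (t y n) * norm x ^ n \<le> C * q ^ n * norm x ^ n"
        using C[of y n] that by (intro mult_right_mono) auto
      then show ?thesis by (simp add: norm_mult norm_power power_mult_distrib mult.assoc)
    qed
    moreover have "summable (\<lambda>n. C * (q * norm x) ^ n)"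
      using x by (intro summable_mult summable_geometric) auto
    ultimately show "\<exists>d h. 0 < d \<and> summable h \<and> (\<forall>\<^sub>F n in sequentially. \<forall>y\<in>ball b d \<inter> B. norm (t y n * x ^ n) \<le> h n)"
      using d(1) by (intro exI[of _ d] exI[of _ "\<lambda>n. C * (q * norm x) ^ n"]) (auto intro!: always_eventually)
  qed
  then obtain g g' where g: "\<And>b. b \<in> B \<Longrightarrow> (\<lambda>n. t b n * x ^ n) sums g b" "\<And>b. b \<in> B \<Longrightarrow> (g has_field_derivative g' b) (at b)"
    by blast
  have "g holomorphic_on B"
    using g(2) assms(1) holomorphic_on_open by blast
  then show ?thesis
    by (rule holomorphic_transform) (use g(1) in \<open>simp add: sums_iff\<close>)
qed

lemma holomorphic_hyp_fun_parameter:
  assumes x: "norm x < 1"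
  shows "(\<lambda>b. hyp_fun b x) holomorphic_on param_dom" "(\<lambda>b. hyp_fun' b x) holomorphic_on param_dom"
proof -
  define r where "r = 2 / (1 + norm x)"
  have "0 < 1 + norm x" by (simp add: add_pos_nonneg)
  then have r: "1 < r" "r * norm x < 1" using x by (auto simp: r_def field_simps)
  show "(\<lambda>b. hyp_fun b x) holomorphic_on param_dom"
    unfolding hyp_fun_def eval_fps_def hyp_fps_def fps_nth_Abs_fps
    by (rule holomorphic_series_in_parameter[OF open_param_dom holomorphic_hyp_coeff _ _ r(2)])
       (use r hyp_coeff_growth in \<open>metis\<close>, use r in simp)
  \<comment> \<open>Differentiating the series brings in the factor n+1. By Bernoulli's inequality
    it is absorbed by one power of q, and the coefficients take the other; hence q * q = r.\<close>
  define q where "q = sqrt r"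
  have q: "1 < q" "q * q = r" using r by (auto simp: q_def)
  have "(\<lambda>b. \<Sum>n. (of_nat (Suc n) * hyp_coeff b (Suc n)) * x ^ n) holomorphic_on param_dom"
  proof (rule holomorphic_series_in_parameter[OF open_param_dom _ _ _ r(2)])
    show "(\<lambda>b. of_nat (Suc n) * hyp_coeff b (Suc n)) holomorphic_on param_dom" for n
      by (intro holomorphic_intros holomorphic_hyp_coeff)
    fix K assume K: "compact K" "K \<subseteq> param_dom"
    obtain C where C: "\<And>b n. b \<in> K \<Longrightarrow> norm (hyp_coeff b n) \<le> C * q ^ n"
      using hyp_coeff_growth[OF K q(1)] by blast
    define C' where "C' = 1 + 1 / (q - 1)"
    have n: "real (Suc n) \<le> C' * q ^ n" for n
    proof -
      have "1 + real n * (q - 1) \<le> q ^ n"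
        using Bernoulli_inequality[of "q - 1" n] q by simp
      then have "real n \<le> q ^ n / (q - 1)" using q by (simp add: field_simps)
      moreover have "1 \<le> q ^ n" using q by simp
      ultimately show ?thesis by (simp add: C'_def algebra_simps)
    qed
    have "norm (of_nat (Suc n) * hyp_coeff b (Suc n)) \<le> C' * C * q * r ^ n" if "b \<in> K" for b n
    proof -
      have "real (Suc n) * norm (hyp_coeff b (Suc n)) \<le> (C' * q ^ n) * (C * q ^ Suc n)"
        using n[of n] q(1) C[OF that, of "Suc n"]
        by (intro mult_mono) (auto simp: C'_def simp del: power_Suc of_nat_Suc)
      then show ?thesis unfolding q(2)[symmetric]
        by (simp add: norm_mult power_mult_distrib mult_ac del: of_nat_Suc)
    qed
    then show "\<exists>C. \<forall>b\<in>K. \<forall>n. norm (of_nat (Suc n) * hyp_coeff b (Suc n)) \<le> C * r ^ n" by blast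
  qed (use r in simp)
  then show "(\<lambda>b. hyp_fun' b x) holomorphic_on param_dom"
    by (simp add: hyp_fun'_def eval_fps_def hyp_fps_def)
qed

subsection \<open>Continuation in the argument\<close>

text \<open>\<open>P\<close> is a branch of the power of \<eta> with exponent -b. It is left open
  because two branches occur: one in the left half-plane, to continue the series itself, and the
  principal one in the upper half-plane.\<close>

definition kummer :: "(complex \<Rightarrow> complex) \<Rightarrow> complex \<Rightarrow> complex \<Rightarrow> complex" where
  "kummer P b \<eta> = P \<eta> * hyp_fun b (1 / \<eta>)"

definition kummer' :: "(complex \<Rightarrow> complex) \<Rightarrow> complex \<Rightarrow> complex \<Rightarrow> complex" where
  "kummer' P b \<eta> = - (P \<eta> / \<eta>) * (b * hyp_fun b (1 / \<eta>) + (1 / \<eta>) * hyp_fun' b (1 / \<eta>))"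

definition ode_coeff :: "complex \<Rightarrow> complex" where
  "ode_coeff \<eta> = - 1 / (\<eta> * (1 - \<eta>))"

text \<open>Of the branch only P' = -b P/\<eta> enters. With x = 1/\<eta> the second derivative is P
  x^2 times b(b+1) F + (2b+2) x F' + x^2 F'', and Gauss' equation collapses this bracket to b(b+1)
  F/(1-x).\<close>

lemma kummer_ode:
  assumes b: "b \<in> param_dom" and \<eta>: "1 < norm \<eta>"
    and P: "(P has_field_derivative - b * P \<eta> / \<eta>) (at \<eta>)"
  shows "(kummer P b has_field_derivative kummer' P b \<eta>) (at \<eta>)"
    "(kummer' P b has_field_derivative (b * (b + 1)) * ode_coeff \<eta> * kummer P b \<eta>) (at \<eta>)"
proof -
  have nz: "\<eta> \<noteq> 0" "1 - \<eta> \<noteq> 0" using \<eta> by auto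
  define x where "x = 1 / \<eta>"
  have x: "norm x < 1" "x \<noteq> 0" "1 - x \<noteq> 0" using \<eta> nz by (auto simp: x_def norm_divide divide_simps)
  have \<eta>x: "\<eta> = 1 / x" by (simp add: x_def)
  have inv: "((\<lambda>\<eta>. 1 / \<eta>) has_field_derivative - x\<^sup>2) (at \<eta>)"
    unfolding x_def using nz by (auto intro!: derivative_eq_intros simp: power2_eq_square)
  define A A' A'' where "A = hyp_fun b x" "A' = hyp_fun' b x" "A'' = hyp_fun'' b x"
  note A = this
  have dA: "((\<lambda>\<eta>. hyp_fun b (1 / \<eta>)) has_field_derivative - x\<^sup>2 * A') (at \<eta>)"
    "((\<lambda>\<eta>. hyp_fun' b (1 / \<eta>)) has_field_derivative - x\<^sup>2 * A'') (at \<eta>)"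
    using DERIV_chain2[where f = "hyp_fun b", OF has_field_derivative_hyp_fun(1)[OF b x(1), unfolded x_def] inv]
      DERIV_chain2[where f = "hyp_fun' b", OF has_field_derivative_hyp_fun(2)[OF b x(1), unfolded x_def] inv]
    by (simp_all add: A x_def mult.commute)
  have "(kummer P b has_field_derivative (- b * P \<eta> / \<eta>) * A + P \<eta> * (- x\<^sup>2 * A')) (at \<eta>)"
    unfolding kummer_def using DERIV_mult[OF P dA(1)] by (simp add: A x_def mult.commute)
  also have "(- b * P \<eta> / \<eta>) * A + P \<eta> * (- x\<^sup>2 * A') = kummer' P b \<eta>"
    unfolding kummer'_def using nz by (simp add: A x_def power2_eq_square field_simps)
  finally show "(kummer P b has_field_derivative kummer' P b \<eta>) (at \<eta>)" .
  have "(kummer' P b has_field_derivative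
      - ((- b * P \<eta> / \<eta>) * x + P \<eta> * (- x\<^sup>2)) * (b * A + x * A')
      + - (P \<eta> * x) * (b * (- x\<^sup>2 * A') + ((- x\<^sup>2) * A' + x * (- x\<^sup>2 * A'')))) (at \<eta>)"
  proof -
    have "((\<lambda>\<eta>. - (P \<eta> * (1 / \<eta>)) * (b * hyp_fun b (1 / \<eta>) + (1 / \<eta>) * hyp_fun' b (1 / \<eta>))) has_field_derivative
      - ((- b * P \<eta> / \<eta>) * x + P \<eta> * (- x\<^sup>2)) * (b * A + x * A')
      + - (P \<eta> * x) * (b * (- x\<^sup>2 * A') + ((- x\<^sup>2) * A' + x * (- x\<^sup>2 * A'')))) (at \<eta>)"
      by (rule derivative_eq_intros P inv dA refl)+ (simp add: A x_def algebra_simps)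
    then show ?thesis by (simp add: kummer'_def[abs_def])
  qed
  also have "- ((- b * P \<eta> / \<eta>) * x + P \<eta> * (- x\<^sup>2)) * (b * A + x * A')
      + - (P \<eta> * x) * (b * (- x\<^sup>2 * A') + ((- x\<^sup>2) * A' + x * (- x\<^sup>2 * A'')))
     = P \<eta> * x\<^sup>2 * (b * (b + 1) * A + (2 * b + 2) * x * A' + x\<^sup>2 * A'')"
    unfolding \<eta>x using x by (simp add: field_simps power2_eq_square)
  also have "\<dots> = (b * (b + 1)) * ode_coeff \<eta> * kummer P b \<eta>"
  proof -
    have ode: "x * ((1 - x) * A'') + (2 * b + 2) * ((1 - x) * A') = b * (b + 1) * A"
      using hyp_fun_ode[OF b x(1)] by (simp add: A)
    have "(1 - x) * (b * (b + 1) * A + (2 * b + 2) * x * A' + x\<^sup>2 * A'') = b * (b + 1) * A"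
      using ode by algebra
    then have "b * (b + 1) * A + (2 * b + 2) * x * A' + x\<^sup>2 * A'' = b * (b + 1) * A / (1 - x)"
      using x(3) by (metis nonzero_mult_div_cancel_left)
    moreover have "ode_coeff \<eta> = x\<^sup>2 / (1 - x)"
    proof -
      have "\<eta> * (1 - \<eta>) = - ((1 - x) / x\<^sup>2)"
        unfolding \<eta>x using x by (simp add: field_simps power2_eq_square)
      then show ?thesis by (simp add: ode_coeff_def)
    qed
    ultimately show ?thesis by (simp add: kummer_def A x_def)
  qed
  finally show "(kummer' P b has_field_derivative (b * (b + 1)) * ode_coeff \<eta> * kummer P b \<eta>) (at \<eta>)" .
qed

text \<open>Unit initial data at \<open>x0\<close> give Wronskian 1 everywhere. The parameter c is
  kept free of b: setting c = b(b+1) later puts a and -a-1 into one and the same system.\<close>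

lemma ode_fundamental_system:
  assumes D: "open D" "x0 \<in> D" "\<And>x. x \<in> D \<Longrightarrow> closed_segment x0 x \<subseteq> D" "0 \<notin> D" "1 \<notin> D"
  obtains U U' V V' where
    "\<And>c x. x \<in> D \<Longrightarrow> (U c has_field_derivative U' c x) (at x)"
    "\<And>c x. x \<in> D \<Longrightarrow> (U' c has_field_derivative c * ode_coeff x * U c x) (at x)"
    "\<And>c x. x \<in> D \<Longrightarrow> (V c has_field_derivative V' c x) (at x)"
    "\<And>c x. x \<in> D \<Longrightarrow> (V' c has_field_derivative c * ode_coeff x * V c x) (at x)"
    "\<And>c x. x \<in> D \<Longrightarrow> U c x * V' c x - U' c x * V c x = 1"
    "\<And>x. x \<in> D \<Longrightarrow> (\<lambda>c. U c x) holomorphic_on UNIV" "\<And>x. x \<in> D \<Longrightarrow> (\<lambda>c. U' c x) holomorphic_on UNIV"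
    "\<And>x. x \<in> D \<Longrightarrow> (\<lambda>c. V c x) holomorphic_on UNIV" "\<And>x. x \<in> D \<Longrightarrow> (\<lambda>c. V' c x) holomorphic_on UNIV"
proof -
  have p: "ode_coeff holomorphic_on D"
    unfolding ode_coeff_def[abs_def] using D(4,5) by (auto intro!: holomorphic_intros)
  obtain U U' where U: "\<And>c x. x \<in> D \<Longrightarrow> (U c has_field_derivative U' c x) (at x)"
    "\<And>c x. x \<in> D \<Longrightarrow> (U' c has_field_derivative c * ode_coeff x * U c x) (at x)"
    and U0: "\<And>c. U c x0 = 1" "\<And>c. U' c x0 = 0"
    and Uh: "\<And>x. x \<in> D \<Longrightarrow> (\<lambda>c. U c x) holomorphic_on UNIV" "\<And>x. x \<in> D \<Longrightarrow> (\<lambda>c. U' c x) holomorphic_on UNIV"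
    by (rule linear_ode_entire_in_parameter[OF D(1,2,3) p, of 1 0]) (assumption | rule that)+
  obtain V V' where V: "\<And>c x. x \<in> D \<Longrightarrow> (V c has_field_derivative V' c x) (at x)"
    "\<And>c x. x \<in> D \<Longrightarrow> (V' c has_field_derivative c * ode_coeff x * V c x) (at x)"
    and V0: "\<And>c. V c x0 = 0" "\<And>c. V' c x0 = 1"
    and Vh: "\<And>x. x \<in> D \<Longrightarrow> (\<lambda>c. V c x) holomorphic_on UNIV" "\<And>x. x \<in> D \<Longrightarrow> (\<lambda>c. V' c x) holomorphic_on UNIV"
    by (rule linear_ode_entire_in_parameter[OF D(1,2,3) p, of 0 1]) (assumption | rule that)+
  have "connected D"
    using D(2,3) by (intro starlike_imp_connected) (auto simp: starlike_def)
  then have "U c x * V' c x - U' c x * V c x = 1" if "x \<in> D" for c x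
    using wronskian_constant[OF D(1) _ that D(2) U V, of c] by (simp add: U0 V0)
  then show thesis using that[OF U V _ Uh Vh] by blast
qed

section \<open>Geometry of the two cut domains\<close>

definition cut_plane :: "complex set" where
  "cut_plane = - complex_of_real ` ({..0} \<union> {1..})"

lemma cut_plane_iff: "x \<in> cut_plane \<longleftrightarrow> Im x \<noteq> 0 \<or> (0 < Re x \<and> Re x < 1)"
  unfolding cut_plane_def by (auto simp: image_iff complex_eq_iff not_le)

lemma open_cut_plane: "open cut_plane"
proof -
  have "cut_plane = - ({x. Im x = 0 \<and> Re x \<le> 0} \<union> {x. Im x = 0 \<and> 1 \<le> Re x})"
    by (auto simp: cut_plane_iff)
  moreover have "closed ({x. Im x = 0 \<and> Re x \<le> 0} \<union> {x. Im x = 0 \<and> 1 \<le> Re x})"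
    by (intro closed_Un closed_Collect_conj closed_Collect_eq closed_Collect_le continuous_intros)
  ultimately show ?thesis by (metis open_Compl)
qed

lemma segment_cut_plane: "x \<in> cut_plane \<Longrightarrow> closed_segment (1/2) x \<subseteq> cut_plane"
proof
  fix w assume x: "x \<in> cut_plane" and "w \<in> closed_segment (1/2) x"
  then obtain t where t: "0 \<le> t" "t \<le> 1" "w = (1 - t) *\<^sub>R (1/2) + t *\<^sub>R x"
    by (auto simp: closed_segment_def)
  show "w \<in> cut_plane"
  proof (cases "Im x = 0 \<or> t = 0")
    case False then show ?thesis using t by (simp add: cut_plane_iff)
  next
    case True
    \<comment> \<open>For t = 0 the point is 1/2 whatever x is, and Re x may lie outside (0,1); 1/2
      is a harmless replacement.\<close>
    define r where "r = (if t = 0 then 1/2 else Re x)"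
    have r: "0 < r" "r < 1" using x True by (auto simp: r_def cut_plane_iff)
    have "Re w = (1 - t) * (1/2) + t * r" using t by (simp add: r_def)
    moreover have "(1 - t) * (1/2) + t * r \<in> {0<..<1}"
      using convexD[OF convex_real_interval(8)[of 0 1], of "1/2" r "1 - t" t] t r by simp
    ultimately show ?thesis by (simp add: cut_plane_iff)
  qed
qed

lemma connected_cut_plane: "connected cut_plane"
proof -
  have "1/2 \<in> cut_plane" by (simp add: cut_plane_iff)
  then show ?thesis
    by (intro starlike_imp_connected) (use segment_cut_plane starlike_def in blast)
qed

text \<open>This domain avoids the singular points 0 and 1, is star-shaped about every negative
  number, and is preserved by x \<mapsto> 1/x. Together with the unit disc it covers the plane cut
  along [1,\<infinity>).\<close>

definition slit_plane :: "complex set" where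
  "slit_plane = - complex_of_real ` {0..}"

lemma slit_plane_iff: "x \<in> slit_plane \<longleftrightarrow> Im x \<noteq> 0 \<or> Re x < 0"
  unfolding slit_plane_def by (auto simp: image_iff complex_eq_iff not_le)

lemma slit_plane_uminus: "x \<in> slit_plane \<Longrightarrow> - x \<notin> \<real>\<^sub>\<le>\<^sub>0"
  by (auto simp: slit_plane_iff complex_nonpos_Reals_iff)

lemma open_slit_plane: "open slit_plane"
proof -
  have "slit_plane = - {x. Im x = 0 \<and> 0 \<le> Re x}"
    by (auto simp: slit_plane_iff)
  moreover have "closed {x. Im x = 0 \<and> 0 \<le> Re x}"
    by (intro closed_Collect_conj closed_Collect_eq closed_Collect_le continuous_intros)
  ultimately show ?thesis by (metis open_Compl)
qed

lemma segment_slit_plane: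
  assumes x: "x \<in> slit_plane" and r: "r < 0"
  shows "closed_segment (of_real r) x \<subseteq> slit_plane"
proof
  fix w assume "w \<in> closed_segment (of_real r) x"
  then obtain t where t: "0 \<le> t" "t \<le> 1" "w = (1 - t) *\<^sub>R of_real r + t *\<^sub>R x"
    by (auto simp: closed_segment_def)
  show "w \<in> slit_plane"
  proof (cases "Im x = 0 \<or> t = 0")
    case False then show ?thesis using t by (simp add: slit_plane_iff)
  next
    case True
    define s where "s = (if t = 0 then -1 else Re x)"
    have s: "s < 0" using x True by (auto simp: s_def slit_plane_iff)
    have "Re w = (1 - t) * r + t * s" using t by (simp add: s_def)
    moreover have "(1 - t) * r + t * s < 0"
      using convexD[OF convex_real_interval(4)[of 0], of r s "1 - t" t] t r s by simp
    ultimately show ?thesis by (simp add: slit_plane_iff)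
  qed
qed

lemma inverse_slit_plane: "x \<in> slit_plane \<Longrightarrow> 1 / x \<in> slit_plane"
  by (auto simp: slit_plane_iff Re_divide Im_divide divide_simps sum_power2_eq_zero_iff)

section \<open>Continuation of the hypergeometric series past the unit circle\<close>

lemma holomorphic_hyp_fun: "b \<in> param_dom \<Longrightarrow> hyp_fun b holomorphic_on ball 0 1"
  unfolding holomorphic_on_open[OF open_ball] using has_field_derivative_hyp_fun(1) by auto blast

text \<open>
  Near infinity in the left half-plane the series is a combination of solutions on the whole slit
  plane, which continue it past the unit circle.
\<close>

lemma hyp_fun_continuation_exists:
  assumes b: "b \<in> param_dom"
  shows "\<exists>F. F holomorphic_on (- complex_of_real ` {1..}) \<and> (\<forall>x\<in>ball 0 1. F x = hyp_fun b x)"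
proof -
  obtain U U' V V' where U: "\<And>c x. x \<in> slit_plane \<Longrightarrow> (U c has_field_derivative U' c x) (at x)"
    "\<And>c x. x \<in> slit_plane \<Longrightarrow> (U' c has_field_derivative c * ode_coeff x * U c x) (at x)"
    and V: "\<And>c x. x \<in> slit_plane \<Longrightarrow> (V c has_field_derivative V' c x) (at x)"
    "\<And>c x. x \<in> slit_plane \<Longrightarrow> (V' c has_field_derivative c * ode_coeff x * V c x) (at x)"
    and W: "\<And>c x. x \<in> slit_plane \<Longrightarrow> U c x * V' c x - U' c x * V c x = 1"
    by (rule ode_fundamental_system[OF open_slit_plane _ segment_slit_plane[of _ "-1"]])
       (auto simp: slit_plane_iff)
  \<comment> \<open>The principal power of -\<eta> is analytic off [0,\<infinity>); that of \<eta>
    would have its cut inside the left half-plane \<open>S\<close>.\<close>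
  define P where "P = (\<lambda>\<eta>::complex. (- \<eta>) powr (- b))"
  have P: "(P has_field_derivative - b * P \<eta> / \<eta>) (at \<eta>)" if "\<eta> \<in> slit_plane" for \<eta>
  proof -
    have "\<eta> \<noteq> 0" using that by (auto simp: slit_plane_iff)
    then show ?thesis
      unfolding P_def using slit_plane_uminus[OF that]
      by (auto intro!: derivative_eq_intros simp: powr_diff field_simps)
  qed
  define S where "S = {\<eta>. Re \<eta> < -1}"
  have S: "open S" "connected S" "-2 \<in> S" "S \<subseteq> slit_plane"
    by (auto simp: S_def slit_plane_iff open_halfspace_Re_lt convex_halfspace_Re_lt intro!: convex_connected)
  have S1: "1 < norm \<eta>" if "\<eta> \<in> S" for \<eta>
    using that abs_Re_le_cmod[of \<eta>] by (auto simp: S_def)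
  define c where "c = b * (b + 1)"
  define \<alpha> where "\<alpha> = kummer P b (-2) * V' c (-2) - kummer' P b (-2) * V c (-2)"
  define \<beta> where "\<beta> = kummer' P b (-2) * U c (-2) - kummer P b (-2) * U' c (-2)"
  define y where "y = (\<lambda>\<eta>. \<alpha> * U c \<eta> + \<beta> * V c \<eta>)"
  have y: "kummer P b \<eta> = y \<eta>" if "\<eta> \<in> S" for \<eta>
    unfolding y_def \<alpha>_def \<beta>_def
  proof (rule solution_in_fundamental_system[OF S(1,2,3) that, where q = "\<lambda>x. c * ode_coeff x"])
    fix x assume x: "x \<in> S"
    then have x': "x \<in> slit_plane" using S(4) by blast
    show "(kummer P b has_field_derivative kummer' P b x) (at x)"
      "(kummer' P b has_field_derivative c * ode_coeff x * kummer P b x) (at x)"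
      unfolding c_def by (intro kummer_ode b S1[OF x] P x')+
    show "(U c has_field_derivative U' c x) (at x)" "(U' c has_field_derivative c * ode_coeff x * U c x) (at x)"
      "(V c has_field_derivative V' c x) (at x)" "(V' c has_field_derivative c * ode_coeff x * V c x) (at x)"
      "U c x * V' c x - U' c x * V c x = 1"
      by (intro U V W x')+
  qed
  have hol: "y holomorphic_on slit_plane"
  proof -
    have "U c holomorphic_on slit_plane" "V c holomorphic_on slit_plane"
      unfolding holomorphic_on_open[OF open_slit_plane] using U(1) V(1) by blast+
    then show ?thesis unfolding y_def by (intro holomorphic_intros)
  qed
  \<comment> \<open>Undoes the factor \<open>P\<close> and returns to the coordinate x = 1/\<eta>,
    so that \<open>F\<close> reproduces \<open>hyp_fun b\<close> wherever 1/x lies in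
    \<open>S\<close>.\<close>
  define F where "F = (\<lambda>x. (- (1 / x)) powr b * y (1 / x))"
  have nz: "x \<noteq> 0" if "x \<in> slit_plane" for x using that by (auto simp: slit_plane_iff)
  have invh: "(\<lambda>x. 1 / x) holomorphic_on slit_plane"
    by (intro holomorphic_intros nz)
  have "(\<lambda>x. y (1 / x)) holomorphic_on slit_plane"
    using holomorphic_on_compose_gen[OF invh hol] inverse_slit_plane by (auto simp: o_def)
  then have Fh: "F holomorphic_on slit_plane"
    unfolding F_def
    by (intro holomorphic_intros nz slit_plane_uminus inverse_slit_plane)
  define s where "s = slit_plane \<inter> (\<lambda>x. 1 / x) -` S"
  have "open s"
    unfolding s_def by (intro continuous_open_preimage holomorphic_on_imp_continuous_on invh open_slit_plane S(1))
  have agree0: "F x = hyp_fun b x" if "x \<in> s" for x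
  proof -
    have x: "x \<in> slit_plane" "1 / x \<in> S" using that by (auto simp: s_def)
    then have "F x = (- (1 / x)) powr b * ((- (1 / x)) powr (- b) * hyp_fun b x)"
      unfolding F_def y[OF x(2), symmetric] by (simp add: kummer_def P_def)
    moreover have "(- (1 / x)) powr b * (- (1 / x)) powr (- b) = 1"
      using nz[OF x(1)] by (simp add: powr_minus)
    ultimately show ?thesis by (metis mult.assoc mult_1)
  qed
  \<comment> \<open>The identity theorem extends the agreement from the preimage of \<open>S\<close>
    to the whole slit disc, which is star-shaped about -1/2.\<close>
  have agree: "F x = hyp_fun b x" if "x \<in> ball 0 1 \<inter> slit_plane" for x
  proof (rule analytic_continuation_open[of s "ball 0 1 \<inter> slit_plane" F "hyp_fun b"])
    show "open (ball 0 1 \<inter> slit_plane)" by (intro open_Int open_ball open_slit_plane)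
    have "-1/2 \<in> s" by (auto simp: s_def S_def slit_plane_iff)
    then show "s \<noteq> {}" by blast
    have seg: "closed_segment (- 1/2) x \<subseteq> ball 0 1 \<inter> slit_plane" if "x \<in> ball 0 1 \<inter> slit_plane" for x
      using segment_slit_plane[of x "- 1/2"] that closed_segment_subset[OF _ _ convex_ball, of "-1/2" 0 1 x]
      by auto
    show "connected (ball 0 1 \<inter> slit_plane)"
    proof (intro starlike_imp_connected)
      have "- 1/2 \<in> ball 0 1 \<inter> slit_plane" by (simp add: slit_plane_iff)
      then show "starlike (ball 0 1 \<inter> slit_plane)" using seg unfolding starlike_def by blast
    qed
    show "s \<subseteq> ball 0 1 \<inter> slit_plane"
    proof
      fix x assume "x \<in> s"
      then have x: "x \<in> slit_plane" "1 < norm (1 / x)" using S1 by (auto simp: s_def)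
      then show "x \<in> ball 0 1 \<inter> slit_plane" using nz[OF x(1)] by (simp add: norm_divide)
    qed
    show "F holomorphic_on ball 0 1 \<inter> slit_plane" "hyp_fun b holomorphic_on ball 0 1 \<inter> slit_plane"
      using Fh holomorphic_hyp_fun[OF b] by (blast intro: holomorphic_on_subset)+
  qed (use \<open>open s\<close> agree0 that in auto)
  \<comment> \<open>Gluing supplies the missing points [0,1), where only the series is
    available.\<close>
  define G where "G = (\<lambda>x. if x \<in> ball 0 1 then hyp_fun b x else F x)"
  have "G holomorphic_on (ball 0 1 \<union> slit_plane)"
    unfolding G_def
    by (rule holomorphic_on_If_Un[OF holomorphic_hyp_fun[OF b] Fh open_ball open_slit_plane])
       (use agree in auto)
  moreover have "- complex_of_real ` {1..} \<subseteq> ball 0 1 \<union> slit_plane"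
  proof
    fix x assume x: "x \<in> - complex_of_real ` {1..}"
    show "x \<in> ball 0 1 \<union> slit_plane"
    proof (rule ccontr)
      assume "x \<notin> ball 0 1 \<union> slit_plane"
      then have "x = of_real (Re x)" "0 \<le> Re x" "1 \<le> norm x"
        by (auto simp: slit_plane_iff complex_eq_iff)
      then show False using x by (metis ComplD abs_of_nonneg atLeast_iff imageI norm_of_real)
    qed
  qed
  ultimately show ?thesis
    using holomorphic_on_subset by (intro exI[of _ G]) (auto simp: G_def)
qed

text \<open>Once a continuation exists, the \<open>SOME\<close> in \<open>hyp2F1\<close> satisfies
  its specification. The value b = -1 is excluded because the lower parameter 2b+2 would be
  0.\<close>

lemma
  assumes b: "b \<in> param_dom" "b \<noteq> -1"
  shows holomorphic_hyp2F1: "hyp2F1 b (b + 1) (2 * b + 2) holomorphic_on (- complex_of_real ` {1..})"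
    and hyp2F1_eq_hyp_fun: "norm x < 1 \<Longrightarrow> hyp2F1 b (b + 1) (2 * b + 2) x = hyp_fun b x"
proof -
  have "\<exists>F. F holomorphic_on (- complex_of_real ` {1..}) \<and>
     (\<forall>x \<in> ball 0 1. F x = eval_fps (fps_hypergeo [b, b + 1] [2 * b + 2] 1) x)"
    using hyp_fun_continuation_exists[OF b(1)] unfolding hyp_coeff_eq_hypergeo[OF b] hyp_fun_def .
  note * = someI_ex[OF this, folded hyp2F1_def]
  show "hyp2F1 b (b + 1) (2 * b + 2) holomorphic_on (- complex_of_real ` {1..})"
    using * by (rule conjunct1)
  show "norm x < 1 \<Longrightarrow> hyp2F1 b (b + 1) (2 * b + 2) x = hyp_fun b x"
    using *[THEN conjunct2, rule_format, of x] unfolding hyp_coeff_eq_hypergeo[OF b] hyp_fun_def mem_ball_0 .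
qed

section \<open>The solutions on the doubly cut plane\<close>

lemma holomorphic_kummer_parameter:
  assumes "1 < norm \<eta>"
  shows "(\<lambda>b. kummer (\<lambda>\<eta>. \<eta> powr (- b)) b \<eta>) holomorphic_on param_dom"
    "(\<lambda>b. kummer' (\<lambda>\<eta>. \<eta> powr (- b)) b \<eta>) holomorphic_on param_dom"
proof -
  have "0 < norm \<eta>" using assms by linarith
  then have "norm (1 / \<eta>) < 1" "\<eta> \<noteq> 0" using assms by (auto simp: norm_divide)
  then show "(\<lambda>b. kummer (\<lambda>\<eta>. \<eta> powr (- b)) b \<eta>) holomorphic_on param_dom"
    "(\<lambda>b. kummer' (\<lambda>\<eta>. \<eta> powr (- b)) b \<eta>) holomorphic_on param_dom"
    unfolding kummer_def kummer'_def powr_def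
    by (auto intro!: holomorphic_intros holomorphic_hyp_fun_parameter)
qed

text \<open>Since a + b = -1, the two powers multiply to \<eta>, which cancels the factor 1/\<eta>
  of the derivatives. What remains is \<open>hyp_fun_wronskian\<close>.\<close>

lemma kummer_wronskian:
  fixes a :: complex
  assumes a: "a \<in> param_dom" "- a - 1 \<in> param_dom" and \<eta>: "1 < norm \<eta>"
  defines "b \<equiv> - a - 1"
  shows "kummer (\<lambda>\<eta>. \<eta> powr (- a)) a \<eta> * kummer' (\<lambda>\<eta>. \<eta> powr (- b)) b \<eta>
       - kummer' (\<lambda>\<eta>. \<eta> powr (- a)) a \<eta> * kummer (\<lambda>\<eta>. \<eta> powr (- b)) b \<eta> = 2 * a + 1"
proof -
  define x where "x = 1 / \<eta>"
  have "0 < norm \<eta>" using \<eta> by linarith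
  then have x: "norm x < 1" "\<eta> \<noteq> 0" using \<eta> by (auto simp: norm_divide x_def)
  have P: "\<eta> powr (- a) * \<eta> powr (- b) = \<eta>"
    using x(2) by (simp add: powr_add[symmetric] b_def)
  define p q where "p = \<eta> powr (- a)" "q = \<eta> powr (- b)"
  define A A' B B' where "A = hyp_fun a x" "A' = hyp_fun' a x" "B = hyp_fun b x" "B' = hyp_fun' b x"
  note defs = this
  have "kummer (\<lambda>\<eta>. \<eta> powr (- a)) a \<eta> * kummer' (\<lambda>\<eta>. \<eta> powr (- b)) b \<eta>
       - kummer' (\<lambda>\<eta>. \<eta> powr (- a)) a \<eta> * kummer (\<lambda>\<eta>. \<eta> powr (- b)) b \<eta>
     = p * A * (- (q * x) * (b * B + x * B')) - (- (p * x) * (a * A + x * A')) * (q * B)"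
    unfolding kummer_def kummer'_def defs p_q_def x_def by simp
  also have "\<dots> = (p * q * x) * ((a - b) * A * B + x * (B * A' - A * B'))"
    by (simp add: algebra_simps)
  also have "p * q * x = 1"
    using P x(2) by (simp add: p_q_def x_def)
  finally show ?thesis
    using hyp_fun_wronskian[OF a x(1)] by (simp add: defs b_def)
qed

text \<open>The candidate g plays two roles: it shows that the \<open>SOME\<close> in
  \<open>cont_upper\<close> has a witness, and the identity theorem on the connected cut plane
  forces the chosen function to equal it.\<close>

lemma cont_upper_eq:
  assumes g: "g holomorphic_on cut_plane" "\<And>\<eta>. 0 < Im \<eta> \<Longrightarrow> g \<eta> = f \<eta>" and \<eta>: "\<eta> \<in> cut_plane"
  shows "cont_upper f \<eta> = g \<eta>"
proof -
  have "\<exists>g. g holomorphic_on (- complex_of_real ` ({..0} \<union> {1..})) \<and> (\<forall>\<eta>. 0 < Im \<eta> \<longrightarrow> g \<eta> = f \<eta>)"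
    using g unfolding cut_plane_def by blast
  note * = someI_ex[OF this, folded cont_upper_def cut_plane_def]
  show ?thesis
  proof (rule analytic_continuation_open[of "{\<eta>. 0 < Im \<eta>}" cut_plane "cont_upper f" g])
    show "{\<eta>. 0 < Im \<eta>} \<noteq> {}" by (auto intro!: exI[of _ \<i>])
    show "open {\<eta>. 0 < Im \<eta>}" by (rule open_halfspace_Im_gt)
    show "{\<eta>. 0 < Im \<eta>} \<subseteq> cut_plane" by (auto simp: cut_plane_iff)
    show "cont_upper f holomorphic_on cut_plane" using * by (rule conjunct1)
    show "cont_upper f \<eta> = g \<eta>" if "\<eta> \<in> {\<eta>. 0 < Im \<eta>}" for \<eta>
      using *[THEN conjunct2] g(2)[of \<eta>] that by simp
  qed (intro open_cut_plane connected_cut_plane g(1) \<eta>)+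
qed

text \<open>\<open>K b\<close> is the combination of the entire-in-c system that matches the series
  at one point. Its coefficients are analytic in b because the series is, and this includes b = -1,
  where only the link to \<open>hyp2F1\<close> is lost.\<close>

lemma kummer_continuation:
  obtains K K' where
    "\<And>\<eta>. \<eta> \<in> cut_plane \<Longrightarrow> (\<lambda>b. K b \<eta>) holomorphic_on param_dom"
    "\<And>\<eta>. \<eta> \<in> cut_plane \<Longrightarrow> (\<lambda>b. K' b \<eta>) holomorphic_on param_dom"
    "\<And>b \<eta>. \<eta> \<in> cut_plane \<Longrightarrow> (K b has_field_derivative K' b \<eta>) (at \<eta>)"
    "\<And>b C \<eta>. b \<in> param_dom \<Longrightarrow> b \<noteq> -1 \<Longrightarrow> \<eta> \<in> cut_plane \<Longrightarrow>
       cont_upper (\<lambda>\<eta>. C * \<eta> powr (- b) * hyp2F1 b (b + 1) (2 * b + 2) (1 / \<eta>)) \<eta> = C * K b \<eta>"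
    "\<And>a \<eta>. a \<in> param_dom \<Longrightarrow> - a - 1 \<in> param_dom \<Longrightarrow> \<eta> \<in> cut_plane \<Longrightarrow>
       K a \<eta> * K' (- a - 1) \<eta> - K' a \<eta> * K (- a - 1) \<eta> = 2 * a + 1"
proof -
  obtain U U' V V' where U: "\<And>c x. x \<in> cut_plane \<Longrightarrow> (U c has_field_derivative U' c x) (at x)"
    "\<And>c x. x \<in> cut_plane \<Longrightarrow> (U' c has_field_derivative c * ode_coeff x * U c x) (at x)"
    and V: "\<And>c x. x \<in> cut_plane \<Longrightarrow> (V c has_field_derivative V' c x) (at x)"
    "\<And>c x. x \<in> cut_plane \<Longrightarrow> (V' c has_field_derivative c * ode_coeff x * V c x) (at x)"
    and W: "\<And>c x. x \<in> cut_plane \<Longrightarrow> U c x * V' c x - U' c x * V c x = 1"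
    and h: "\<And>x. x \<in> cut_plane \<Longrightarrow> (\<lambda>c. U c x) holomorphic_on UNIV" "\<And>x. x \<in> cut_plane \<Longrightarrow> (\<lambda>c. U' c x) holomorphic_on UNIV"
    "\<And>x. x \<in> cut_plane \<Longrightarrow> (\<lambda>c. V c x) holomorphic_on UNIV" "\<And>x. x \<in> cut_plane \<Longrightarrow> (\<lambda>c. V' c x) holomorphic_on UNIV"
    by (rule ode_fundamental_system[OF open_cut_plane _ segment_cut_plane])
       (auto simp: cut_plane_iff)
  define c where "c = (\<lambda>b::complex. b * (b + 1))"
  define k where "k = (\<lambda>b. kummer (\<lambda>\<eta>. \<eta> powr (- b)) b)"
  define k' where "k' = (\<lambda>b. kummer' (\<lambda>\<eta>. \<eta> powr (- b)) b)"
  \<comment> \<open>The matching point must lie outside the closed unit disc, for convergence at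
    1/\<eta>, and in the upper half-plane, where \<open>cont_upper\<close> is anchored.\<close>
  define \<zeta> where "\<zeta> = 2 * \<i>"
  define \<alpha> where "\<alpha> = (\<lambda>b. k b \<zeta> * V' (c b) \<zeta> - k' b \<zeta> * V (c b) \<zeta>)"
  define \<beta> where "\<beta> = (\<lambda>b. k' b \<zeta> * U (c b) \<zeta> - k b \<zeta> * U' (c b) \<zeta>)"
  define K where "K = (\<lambda>b \<eta>. \<alpha> b * U (c b) \<eta> + \<beta> b * V (c b) \<eta>)"
  define K' where "K' = (\<lambda>b \<eta>. \<alpha> b * U' (c b) \<eta> + \<beta> b * V' (c b) \<eta>)"
  have \<zeta>: "\<zeta> \<in> cut_plane" "1 < norm \<zeta>" by (auto simp: \<zeta>_def cut_plane_iff norm_mult)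
  have ch: "(\<lambda>b. f (c b)) holomorphic_on param_dom" if "f holomorphic_on UNIV" for f
  proof -
    have "c holomorphic_on param_dom" unfolding c_def by (intro holomorphic_intros)
    from holomorphic_on_compose_gen[OF this that] show ?thesis by (simp add: o_def)
  qed
  note uv = h[THEN ch]
  have kh: "(\<lambda>b. k b \<zeta>) holomorphic_on param_dom" "(\<lambda>b. k' b \<zeta>) holomorphic_on param_dom"
    unfolding k_def k'_def by (intro holomorphic_kummer_parameter \<zeta>)+
  have ab: "\<alpha> holomorphic_on param_dom" "\<beta> holomorphic_on param_dom"
    unfolding \<alpha>_def \<beta>_def by (intro holomorphic_intros kh uv \<zeta>)+
  have Kh: "(\<lambda>b. K b \<eta>) holomorphic_on param_dom" "(\<lambda>b. K' b \<eta>) holomorphic_on param_dom"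
    if "\<eta> \<in> cut_plane" for \<eta>
    unfolding K_def K'_def by (intro holomorphic_intros ab uv that)+
  have dK: "(K b has_field_derivative K' b \<eta>) (at \<eta>)" if "\<eta> \<in> cut_plane" for b \<eta>
    unfolding K_def K'_def by (intro DERIV_add DERIV_cmult U V that)
  \<comment> \<open>A connected region around \<open>\<zeta>\<close> on which the series converges
    and the principal power is analytic. The identity theorem later passes from it to the whole
    upper half-plane.\<close>
  define S where "S = {\<eta>. 1 < Im \<eta>}"
  have S: "open S" "connected S" "\<zeta> \<in> S" "S \<subseteq> cut_plane"
    by (auto simp: S_def \<zeta>_def cut_plane_iff open_halfspace_Im_gt convex_halfspace_Im_gt intro!: convex_connected)
  have S1: "1 < norm \<eta>" if "\<eta> \<in> S" for \<eta>
    using that abs_Im_le_cmod[of \<eta>] by (auto simp: S_def)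
  have kK: "k b \<eta> = K b \<eta>" if "b \<in> param_dom" "\<eta> \<in> S" for b \<eta>
    unfolding K_def \<alpha>_def \<beta>_def
  proof (rule solution_in_fundamental_system[OF S(1,2,3) that(2), where q = "\<lambda>x. c b * ode_coeff x"])
    fix x assume x: "x \<in> S"
    then have x': "x \<in> cut_plane" using S(4) by blast
    have "x \<notin> \<real>\<^sub>\<le>\<^sub>0" using x by (auto simp: S_def complex_nonpos_Reals_iff)
    moreover have "x \<noteq> 0" using x by (auto simp: S_def)
    ultimately have P: "((\<lambda>\<eta>. \<eta> powr (- b)) has_field_derivative - b * x powr (- b) / x) (at x)"
      by (auto intro!: derivative_eq_intros simp: powr_diff)
    show "(k b has_field_derivative k' b x) (at x)"
      "(k' b has_field_derivative c b * ode_coeff x * k b x) (at x)"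
      unfolding c_def k_def k'_def using kummer_ode[OF that(1) S1[OF x] P] by simp_all
    show "(U (c b) has_field_derivative U' (c b) x) (at x)" "(U' (c b) has_field_derivative c b * ode_coeff x * U (c b) x) (at x)"
      "(V (c b) has_field_derivative V' (c b) x) (at x)" "(V' (c b) has_field_derivative c b * ode_coeff x * V (c b) x) (at x)"
      "U (c b) x * V' (c b) x - U' (c b) x * V (c b) x = 1"
      by (intro U V W x')+
  qed
  have cont: "cont_upper (\<lambda>\<eta>. C * \<eta> powr (- b) * hyp2F1 b (b + 1) (2 * b + 2) (1 / \<eta>)) \<eta> = C * K b \<eta>"
    if b: "b \<in> param_dom" "b \<noteq> -1" and \<eta>: "\<eta> \<in> cut_plane" for b C \<eta>
  proof (rule cont_upper_eq[OF _ _ \<eta>])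
    have Kbh: "K b holomorphic_on cut_plane"
      unfolding holomorphic_on_open[OF open_cut_plane] using dK by blast
    then show "(\<lambda>\<eta>. C * K b \<eta>) holomorphic_on cut_plane" by (intro holomorphic_intros)
    fix \<eta> :: complex assume \<eta>: "0 < Im \<eta>"
    have "K b \<eta> = \<eta> powr (- b) * hyp2F1 b (b + 1) (2 * b + 2) (1 / \<eta>)"
    proof (rule analytic_continuation_open[of S "{\<eta>. 0 < Im \<eta>}" "K b"
          "\<lambda>\<eta>. \<eta> powr (- b) * hyp2F1 b (b + 1) (2 * b + 2) (1 / \<eta>)"])
      show "K b holomorphic_on {\<eta>. 0 < Im \<eta>}"
        using Kbh by (rule holomorphic_on_subset) (auto simp: cut_plane_iff)
    next
      have nz: "x \<noteq> 0" "x \<notin> \<real>\<^sub>\<le>\<^sub>0" if "x \<in> {\<eta>. 0 < Im \<eta>}" for x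
        using that by (auto simp: complex_nonpos_Reals_iff)
      have invh: "(\<lambda>x. 1 / x) holomorphic_on {\<eta>. 0 < Im \<eta>}"
        by (intro holomorphic_intros nz)
      have "1 / x \<in> - complex_of_real ` {1..}" if "x \<in> {\<eta>. 0 < Im \<eta>}" for x
      proof
        assume "1 / x \<in> complex_of_real ` {1..}"
        then obtain r where "1 / x = of_real r" by blast
        then have "x = of_real (1 / r)" by (metis div_by_1 divide_divide_eq_right mult_1 of_real_1 of_real_divide)
        then show False using that by simp
      qed
      then have "(\<lambda>x. 1 / x) ` {\<eta>. 0 < Im \<eta>} \<subseteq> - complex_of_real ` {1..}"
        by (rule image_subsetI)
      then have "(\<lambda>x. hyp2F1 b (b + 1) (2 * b + 2) (1 / x)) holomorphic_on {\<eta>. 0 < Im \<eta>}"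
        using holomorphic_on_compose_gen[OF invh holomorphic_hyp2F1[OF b]] by (simp add: o_def)
      then show "(\<lambda>\<eta>. \<eta> powr (- b) * hyp2F1 b (b + 1) (2 * b + 2) (1 / \<eta>)) holomorphic_on {\<eta>. 0 < Im \<eta>}"
        by (intro holomorphic_intros nz)
    next
      fix x assume x: "x \<in> S"
      have "0 < norm x" using S1[OF x] by linarith
      then have "norm (1 / x) < 1" using S1[OF x] by (simp add: norm_divide)
      then show "K b x = x powr (- b) * hyp2F1 b (b + 1) (2 * b + 2) (1 / x)"
        using kK[OF b(1) x] hyp2F1_eq_hyp_fun[OF b] by (simp add: k_def kummer_def)
    qed (use S \<eta> in \<open>auto simp: S_def open_halfspace_Im_gt convex_halfspace_Im_gt intro!: convex_connected\<close>)
    then show "C * K b \<eta> = C * \<eta> powr (- b) * hyp2F1 b (b + 1) (2 * b + 2) (1 / \<eta>)" by simp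
  qed
  have wr: "K a \<eta> * K' (- a - 1) \<eta> - K' a \<eta> * K (- a - 1) \<eta> = 2 * a + 1"
    if a: "a \<in> param_dom" "- a - 1 \<in> param_dom" and \<eta>: "\<eta> \<in> cut_plane" for a \<eta>
  proof -
    define b where "b = - a - 1"
    \<comment> \<open>Both solutions belong to the same fundamental system, so their Wronskian is
      the determinant of the coefficients, the same at every point; at \<open>\<zeta>\<close> the
      series gives its value.\<close>
    have cb: "c b = c a" by (simp add: c_def b_def algebra_simps)
    have "K a \<eta> * K' b \<eta> - K' a \<eta> * K b \<eta> = (\<alpha> a * \<beta> b - \<beta> a * \<alpha> b) * (U (c a) \<eta> * V' (c a) \<eta> - U' (c a) \<eta> * V (c a) \<eta>)"
      unfolding K_def K'_def cb by (simp add: algebra_simps)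
    also have "\<dots> = \<alpha> a * \<beta> b - \<beta> a * \<alpha> b" using W[OF \<eta>] by simp
    also have "\<dots> = (k a \<zeta> * k' b \<zeta> - k' a \<zeta> * k b \<zeta>) * (U (c a) \<zeta> * V' (c a) \<zeta> - U' (c a) \<zeta> * V (c a) \<zeta>)"
      unfolding \<alpha>_def \<beta>_def cb by (simp add: algebra_simps)
    also have "\<dots> = 2 * a + 1"
      using W[OF \<zeta>(1)] kummer_wronskian[OF a \<zeta>(2)] by (simp add: k_def k'_def b_def)
    finally show ?thesis by (simp add: b_def)
  qed
  show thesis by (rule that[of K K']) (use Kh dK cont wr in auto)
qed

subsection \<open>The matrix as a function of the exponent\<close>

lemma mat2_nth [simp]:
  "mat2 p q r s $ 1 $ 1 = p" "mat2 p q r s $ 1 $ 2 = q" "mat2 p q r s $ 2 $ 1 = r" "mat2 p q r s $ 2 $ 2 = s"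
  by simp_all

lemma mat2_mult:
  "mat2 p q r s ** mat2 p' q' r' s' = mat2 (p * p' + q * r') (p * q' + q * s') (r * p' + s * r') (r * q' + s * s')"
  by (simp add: vec_eq_iff forall_2 matrix_matrix_mult_def sum_2)

lemma mat_1_eq_mat2: "mat 1 = mat2 1 0 0 1"
  by (simp add: vec_eq_iff forall_2 mat_def)

lemma matrix_inv_eqI:
  fixes A B :: "complex^2^2"
  assumes "A ** B = mat 1" "B ** A = mat 1"
  shows "matrix_inv A = B"
proof -
  have "A ** matrix_inv A = mat 1 \<and> matrix_inv A ** A = mat 1"
    unfolding matrix_inv_def by (rule someI[where x = B]) (use assms in simp)
  then have "matrix_inv A = matrix_inv A ** (A ** B)" using assms by simp
  also have "\<dots> = (matrix_inv A ** A) ** B" by (rule matrix_mul_assoc)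
  also have "\<dots> = B" using \<open>A ** matrix_inv A = mat 1 \<and> matrix_inv A ** A = mat 1\<close> by simp
  finally show ?thesis .
qed

lemma matrix_inv_mat2:
  assumes "d = p * s - q * r" "d \<noteq> 0"
  shows "matrix_inv (mat2 p q r s) = mat2 (s / d) (- q / d) (- r / d) (p / d)"
proof -
  have "p * s / d - q * r / d = 1"
    using assms by (simp flip: diff_divide_distrib)
  then show ?thesis
    by (intro matrix_inv_eqI) (simp_all add: mat2_mult mat_1_eq_mat2 mult.commute)
qed

definition mat_holomorphic_on :: "(complex \<Rightarrow> complex^2^2) \<Rightarrow> complex set \<Rightarrow> bool" where
  "mat_holomorphic_on F S \<longleftrightarrow> (\<forall>i j. (\<lambda>a. F a $ i $ j) holomorphic_on S)"

lemma mat_holomorphic_on_mat2: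
  assumes "p holomorphic_on S" "q holomorphic_on S" "r holomorphic_on S" "s holomorphic_on S"
  shows "mat_holomorphic_on (\<lambda>a. mat2 (p a) (q a) (r a) (s a)) S"
  unfolding mat_holomorphic_on_def forall_2 using assms by simp

lemma mat_holomorphic_on_mult:
  assumes "mat_holomorphic_on F S" "mat_holomorphic_on G S"
  shows "mat_holomorphic_on (\<lambda>a. F a ** G a) S"
  using assms unfolding mat_holomorphic_on_def
  by (auto simp: matrix_matrix_mult_def intro!: holomorphic_intros)

text \<open>Every singularity that the conjugated matrix has in the strip \<open>\<bar>Re a\<bar> < 1\<close> lies at \<open>\<plusminus>1/2\<close>.\<close>

definition exponent_dom :: "complex set" where
  "exponent_dom = {a. \<bar>Re a\<bar> < 1 \<and> a \<noteq> 1/2 \<and> a \<noteq> -1/2}"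

lemma open_exponent_dom: "open exponent_dom"
proof -
  have "exponent_dom = {a. -1 < Re a} \<inter> {a. Re a < 1} - {1/2, -1/2}"
    by (auto simp: exponent_dom_def)
  moreover have "open ({a. -1 < Re a} \<inter> {a. Re a < 1} - {1/2, -1/2})"
    by (intro open_Diff open_Int open_halfspace_Re_gt open_halfspace_Re_lt finite_imp_closed) auto
  ultimately show ?thesis by metis
qed

lemma exponent_domI: "\<bar>Re a\<bar> < 1 \<Longrightarrow> Im a \<noteq> 0 \<or> \<bar>Re a\<bar> < 1/2 \<Longrightarrow> a \<in> exponent_dom"
  by (auto simp: exponent_dom_def complex_eq_iff)

text \<open>The two punctures at work: a \<noteq> 1/2 keeps -a-1 away from -3/2, and a \<noteq> -1/2
  keeps the Wronskian 2a+1 from vanishing.\<close>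

lemma exponent_dom_param:
  assumes "a \<in> exponent_dom"
  shows "a \<in> param_dom" "- a - 1 \<in> param_dom" "a \<noteq> -1" "a \<noteq> 0 \<Longrightarrow> - a - 1 \<noteq> -1" "2 * a + 1 \<noteq> 0" "a + 1 \<noteq> 0"
proof -
  have a: "-1 < Re a" "Re a < 1" "a \<noteq> 1/2" "a \<noteq> -1/2" using assms by (auto simp: exponent_dom_def)
  show "a \<in> param_dom" "a \<noteq> -1" using a(1) by (auto simp: param_dom_def)
  show "- a - 1 \<in> param_dom" using a by (auto simp: param_dom_def complex_eq_iff)
  show "a \<noteq> 0 \<Longrightarrow> - a - 1 \<noteq> -1" by simp
  show "2 * a + 1 \<noteq> 0" "a + 1 \<noteq> 0" using a by (auto simp: complex_eq_iff)
qed

section \<open>Nonvanishing of the factors of Q\<close>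

lemma sin_pi_nonzero:
  assumes "\<bar>Re a\<bar> < 1" "a \<noteq> 0"
  shows "sin (of_real pi * a) \<noteq> 0"
proof
  assume "sin (of_real pi * a) = 0"
  then obtain n :: int where n: "of_real pi * a = of_real (of_int n * pi)"
    unfolding sin_eq_0 by auto
  then have "a = of_int n" by (simp add: field_simps)
  with assms show False by (simp add: complex_eq_iff)
qed

lemma cos_pi_nonzero:
  assumes "\<bar>Re a\<bar> < 1" "a \<noteq> 1/2" "a \<noteq> -1/2"
  shows "cos (of_real pi * a) \<noteq> 0"
proof
  assume "cos (of_real pi * a) = 0"
  then obtain n :: int where n: "of_real pi * a = of_int n * of_real pi + of_real pi / 2"
    unfolding cos_eq_0 by auto
  then have "of_real pi * a = of_real pi * (of_int n + 1/2)" by (simp add: algebra_simps)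
  then have a: "a = of_int n + 1/2" by simp
  then have "Re a = of_int n + 1/2" by simp
  then have "n = 0 \<or> n = -1" using assms(1) by linarith
  with a assms(2,3) show False by (auto simp: field_simps)
qed

text \<open>The expression is the determinant of the right-hand factor of \<open>Q_mat\<close>; it
  equals 2 e cos (\<pi> a) with e = exp (\<pi> i a).\<close>

lemma exp_pi_nonzero:
  assumes "\<bar>Re a\<bar> < 1" "a \<noteq> 1/2" "a \<noteq> -1/2"
  shows "1 + (exp (a * of_real pi * \<i>))\<^sup>2 \<noteq> 0"
proof
  define e where "e = exp (a * of_real pi * \<i>)"
  assume "1 + (exp (a * of_real pi * \<i>))\<^sup>2 = 0"
  then have e2: "1 + e\<^sup>2 = 0" unfolding e_def .
  have e0: "e \<noteq> 0" unfolding e_def by simp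
  then have "e * (e + inverse e) = 1 + e\<^sup>2" by (simp add: distrib_left power2_eq_square)
  with e2 e0 have "e + inverse e = 0" by simp
  moreover have "2 * cos (of_real pi * a) = e + inverse e"
    by (simp add: cos_exp_eq e_def exp_minus[symmetric] mult_ac)
  ultimately show False using cos_pi_nonzero[OF assms] by simp
qed

text \<open>Quotient of the two diagonal entries of \<open>Q\<close>, with the common zero at \<open>a = 0\<close> removed by the reflection formula.\<close>

definition diag_quot :: "complex \<Rightarrow> complex" where
  "diag_quot a = - (4 powr (2 * a + 1) * exp (a * of_real pi * \<i>) * Gamma (a + 3/2) * Gamma (1 - a)
     * rGamma (1/2 - a) * rGamma (a + 2))"

lemma not_nonpos_Ints_Re: "0 < Re x \<Longrightarrow> x \<notin> \<int>\<^sub>\<le>\<^sub>0"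
  by (auto elim!: nonpos_Ints_cases)

lemma half_not_nonpos_Ints:
  assumes "a \<in> exponent_dom"
  shows "1/2 - a \<notin> \<int>\<^sub>\<le>\<^sub>0" "a + 1/2 \<notin> \<int>\<^sub>\<le>\<^sub>0"
proof -
  have a: "-1 < Re a" "Re a < 1" "a \<noteq> 1/2" "a \<noteq> -1/2" using assms by (auto simp: exponent_dom_def)
  have *: "x = 0" if "x \<in> \<int>\<^sub>\<le>\<^sub>0" "-1 < Re x" for x :: complex
    using that by (auto elim!: nonpos_Ints_cases)
  have "1/2 - a \<noteq> 0" "a + 1/2 \<noteq> 0" using a(3,4) by (auto simp: add_eq_0_iff2)
  moreover have "-1 < Re (1/2 - a)" "-1 < Re (a + 1/2)" using a(1,2) by simp_all
  ultimately show "1/2 - a \<notin> \<int>\<^sub>\<le>\<^sub>0" "a + 1/2 \<notin> \<int>\<^sub>\<le>\<^sub>0" using * by blast+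
qed

lemma holomorphic_diag_quot: "diag_quot holomorphic_on exponent_dom"
  unfolding diag_quot_def
  by (intro holomorphic_intros not_nonpos_Ints_Re) (auto simp: exponent_dom_def)

lemma diag_quot_nonzero:
  assumes "a \<in> exponent_dom"
  shows "diag_quot a \<noteq> 0"
proof -
  have "a + 3/2 \<notin> \<int>\<^sub>\<le>\<^sub>0" "1 - a \<notin> \<int>\<^sub>\<le>\<^sub>0" "a + 2 \<notin> \<int>\<^sub>\<le>\<^sub>0"
    using assms by (auto simp: exponent_dom_def intro!: not_nonpos_Ints_Re)
  then have "Gamma (a + 3/2) \<noteq> 0" "Gamma (1 - a) \<noteq> 0" "rGamma (a + 2) \<noteq> 0"
    by (simp_all add: Gamma_eq_zero_iff rGamma_eq_zero_iff)
  then show ?thesis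
    using half_not_nonpos_Ints[OF assms] by (simp add: diag_quot_def rGamma_eq_zero_iff)
qed

text \<open>Reflection is used twice: at a it trades 1/Gamma(a) for Gamma(1-a) and a sine, at a +
  1/2 it trades Gamma(a+1/2) for 1/Gamma(1/2-a) and a cosine. The sine and the cosine make up the
  tangent.\<close>

lemma diag_quot_eq:
  assumes a: "a \<in> exponent_dom" "a \<noteq> 0"
  defines "d1 \<equiv> - tan (a * of_real pi)"
  defines "d2 \<equiv> 4 powr (2 * a + 1) * exp (a * of_real pi * \<i>)
               * (Gamma (a + 3/2) * Gamma (a + 1/2)) / (Gamma a * Gamma (a + 2))"
  shows "d2 = diag_quot a * d1" "d1 \<noteq> 0"
proof -
  have a': "\<bar>Re a\<bar> < 1" "a \<noteq> 1/2" "a \<noteq> -1/2" using a by (auto simp: exponent_dom_def)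
  define s c where "s = sin (of_real pi * a)" "c = cos (of_real pi * a)"
  have sc: "s \<noteq> 0" "c \<noteq> 0" using sin_pi_nonzero[OF a'(1) a(2)] cos_pi_nonzero[OF a'] by (auto simp: s_c_def)
  have d1: "d1 = - s / c" by (simp add: d1_def tan_def s_c_def mult.commute)
  then show "d1 \<noteq> 0" using sc by simp
  have r1: "Gamma a * Gamma (1 - a) = of_real pi / s"
    unfolding s_c_def by (rule Gamma_reflection_complex)
  have "Gamma (a + 1/2) * Gamma (1/2 - a) = of_real pi / sin (of_real pi * (a + 1/2))"
    using Gamma_reflection_complex[of "a + 1/2"] by (simp add: algebra_simps)
  also have "sin (of_real pi * (a + 1/2)) = c"
  proof -
    have "sin (of_real (pi / 2) :: complex) = 1" "cos (of_real (pi / 2) :: complex) = 0"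
      by (simp_all only: sin_of_real cos_of_real sin_pi_half cos_pi_half of_real_1 of_real_0)
    moreover have "of_real pi * (a + 1/2) = of_real pi * a + of_real (pi / 2)" by (simp add: algebra_simps)
    ultimately show ?thesis by (simp only: sin_add s_c_def) simp
  qed
  finally have r2: "Gamma (a + 1/2) * Gamma (1/2 - a) = of_real pi / c" .
  have nz: "Gamma a \<noteq> 0" "Gamma (1/2 - a) \<noteq> 0"
    using r1 r2 sc by auto
  have "Gamma (1 - a) = of_real pi / (s * Gamma a)" "Gamma (a + 1/2) = of_real pi / (c * Gamma (1/2 - a))"
    using r1 r2 sc nz by (simp_all add: field_simps)
  \<comment> \<open>For g = 0 both sides are 0 by the convention on division.\<close>
  moreover have "X * e * (G * (p / (c * Gh))) / (Ga * g) = - (X * e * G * (p / (s * Ga)) * inverse Gh * inverse g) * (- s / c)"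
    if "s \<noteq> 0" "c \<noteq> 0" "Ga \<noteq> 0" "Gh \<noteq> 0" for X e G p c s Gh Ga g :: complex
    using that by (cases "g = 0") (simp_all add: field_simps)
  ultimately show "d2 = diag_quot a * d1"
    unfolding d2_def d1 diag_quot_def rGamma_inverse_Gamma using sc nz by simp
qed

text \<open>\<open>M1\<close> is the Moebius map taking bL, 0, bR to 0, \<infinity>, 1, so the
  segment [bL,bR] is the preimage of the two cuts together with \<infinity>.\<close>

lemma M1_in_cut_plane:
  assumes b: "bL < 0" "0 < bR" and z: "z \<notin> seg bL bR"
  shows "M1 bL bR z \<in> cut_plane"
proof (cases z)
  case Infty
  have "M1 bL bR z = of_real (bR / (bR - bL))" by (simp add: Infty)
  moreover have "0 < bR / (bR - bL)" "bR / (bR - bL) < 1" using b by (simp_all add: field_simps)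
  ultimately show ?thesis by (simp add: cut_plane_iff)
next
  case (Fin x)
  have mem: "x \<noteq> of_real t" if "bL \<le> t" "t \<le> bR" for t
    using z that by (auto simp: seg_def Fin)
  have x0: "x \<noteq> 0" using mem[of 0] b by simp
  show ?thesis
  proof (rule ccontr)
    assume "M1 bL bR z \<notin> cut_plane"
    then obtain m where m: "M1 bL bR z = of_real m" "m \<le> 0 \<or> 1 \<le> m"
      by (auto simp: cut_plane_def)
    \<comment> \<open>Solving M1 = m for x gives x = bR bL / d. The cut m \<le> 0 leads back to
      [bL,0) and the cut m \<ge> 1 to (0,bR].\<close>
    define d where "d = bR - (bR - bL) * m"
    have "of_real bR * (x - of_real bL) = of_real m * (x * (of_real bR - of_real bL))"
      using m(1) x0 b by (simp add: Fin field_simps)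
    then have "x * of_real d = of_real (bR * bL)"
      unfolding d_def of_real_mult of_real_diff by algebra
    moreover have d0: "d \<noteq> 0" using calculation b by auto
    ultimately have x: "x = of_real (bR * bL / d)" by (simp add: field_simps)
    have "bL \<le> bR * bL / d \<and> bR * bL / d \<le> bR"
    proof (cases "m \<le> 0")
      case True
      then have "(bR - bL) * m \<le> 0" using b by (simp add: mult_nonneg_nonpos)
      then have d: "bR \<le> d" by (simp add: d_def)
      then have q: "bR / d \<le> 1" "0 \<le> bR / d" using b by simp_all
      have "1 * bL \<le> (bR / d) * bL" using q b by (intro mult_right_mono_neg) auto
      moreover have "(bR / d) * bL \<le> 0" using q b by (intro mult_nonneg_nonpos) auto
      ultimately show ?thesis using b by simp
    next
      case False
      then have "(bR - bL) * 1 \<le> (bR - bL) * m" using m(2) b by (intro mult_left_mono) auto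
      then have d: "d \<le> bL" by (simp add: d_def)
      then have q: "bL / d \<le> 1" "0 \<le> bL / d" using b by (simp_all add: divide_le_eq zero_le_divide_iff)
      have "bR * (bL / d) \<le> bR * 1" using q b by (intro mult_left_mono) auto
      moreover have "0 \<le> bR * (bL / d)" using q b by (intro mult_nonneg_nonneg) auto
      ultimately show ?thesis using b by simp
    qed
    with mem x show False by blast
  qed
qed

text \<open>\<open>H\<close> and \<open>Hi\<close> are the substitutes for \<open>Gamma_hat\<close>
  and its inverse that stay analytic at a = 0. \<open>Hi\<close> is the adjugate over the constant
  determinant: the exponential prefactors multiply to -1, which turns the Wronskian 2a+1 into
  -(2a+1).\<close>

lemma Gamma_hat_analytic_in_exponent:
  obtains H Hi where
    "\<And>\<eta>. \<eta> \<in> cut_plane \<Longrightarrow> mat_holomorphic_on (\<lambda>a. H a \<eta>) exponent_dom"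
    "\<And>\<eta>. \<eta> \<in> cut_plane \<Longrightarrow> mat_holomorphic_on (\<lambda>a. Hi a \<eta>) exponent_dom"
    "\<And>a \<eta>. a \<in> exponent_dom \<Longrightarrow> a \<noteq> 0 \<Longrightarrow> \<eta> \<in> cut_plane \<Longrightarrow> Gamma_hat a \<eta> = H a \<eta>"
    "\<And>a \<eta>. a \<in> exponent_dom \<Longrightarrow> a \<noteq> 0 \<Longrightarrow> \<eta> \<in> cut_plane \<Longrightarrow> matrix_inv (Gamma_hat a \<eta>) = Hi a \<eta>"
proof -
  obtain K K' where
    Kh: "\<And>\<eta>. \<eta> \<in> cut_plane \<Longrightarrow> (\<lambda>b. K b \<eta>) holomorphic_on param_dom"
      "\<And>\<eta>. \<eta> \<in> cut_plane \<Longrightarrow> (\<lambda>b. K' b \<eta>) holomorphic_on param_dom"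
    and dK: "\<And>b \<eta>. \<eta> \<in> cut_plane \<Longrightarrow> (K b has_field_derivative K' b \<eta>) (at \<eta>)"
    and cont: "\<And>b C \<eta>. b \<in> param_dom \<Longrightarrow> b \<noteq> -1 \<Longrightarrow> \<eta> \<in> cut_plane \<Longrightarrow>
       cont_upper (\<lambda>\<eta>. C * \<eta> powr (- b) * hyp2F1 b (b + 1) (2 * b + 2) (1 / \<eta>)) \<eta> = C * K b \<eta>"
    and wr: "\<And>a \<eta>. a \<in> param_dom \<Longrightarrow> - a - 1 \<in> param_dom \<Longrightarrow> \<eta> \<in> cut_plane \<Longrightarrow>
       K a \<eta> * K' (- a - 1) \<eta> - K' a \<eta> * K (- a - 1) \<eta> = 2 * a + 1"
    by (rule kummer_continuation) (assumption | rule that)+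
  define C where "C = (\<lambda>a. exp (a * of_real pi * \<i>))"
  define C' where "C' = (\<lambda>a. - exp (- a * of_real pi * \<i>))"
  define h where "h = (\<lambda>a \<eta>. C a * K a \<eta>)"
  define s where "s = (\<lambda>a \<eta>. C' a * K (- a - 1) \<eta>)"
  define h' where "h' = (\<lambda>a \<eta>. C a * K' a \<eta>)"
  define s' where "s' = (\<lambda>a \<eta>. C' a * K' (- a - 1) \<eta>)"
  define H where "H = (\<lambda>a \<eta>. mat2 (h a \<eta>) (s a \<eta>) (h' a \<eta>) (s' a \<eta>))"
  define Hi where "Hi = (\<lambda>a \<eta>. mat2 (s' a \<eta> / - (2 * a + 1)) (- s a \<eta> / - (2 * a + 1))
    (- h' a \<eta> / - (2 * a + 1)) (h a \<eta> / - (2 * a + 1)))"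
  have sub: "exponent_dom \<subseteq> param_dom" using exponent_dom_param(1) by blast
  have neg: "(\<lambda>a. f (- a - 1)) holomorphic_on exponent_dom" if "f holomorphic_on param_dom" for f
  proof -
    have "(\<lambda>a. - a - 1) holomorphic_on exponent_dom" by (intro holomorphic_intros)
    from holomorphic_on_compose_gen[OF this that] exponent_dom_param(2)
    show ?thesis by (auto simp: o_def)
  qed
  have hol: "(\<lambda>a. h a \<eta>) holomorphic_on exponent_dom" "(\<lambda>a. s a \<eta>) holomorphic_on exponent_dom"
    "(\<lambda>a. h' a \<eta>) holomorphic_on exponent_dom" "(\<lambda>a. s' a \<eta>) holomorphic_on exponent_dom"
    if "\<eta> \<in> cut_plane" for \<eta>
    unfolding h_def h'_def s_def s'_def C_def C'_def
    by (intro holomorphic_intros neg[of "\<lambda>a. K a \<eta>"] neg[of "\<lambda>a. K' a \<eta>"]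
        Kh[OF that, THEN holomorphic_on_subset, OF sub] Kh[OF that])+
  have nz: "- (2 * a + 1) \<noteq> 0" if "a \<in> exponent_dom" for a
    using exponent_dom_param(5)[OF that] by (metis neg_equal_0_iff_equal)
  have H: "mat_holomorphic_on (\<lambda>a. H a \<eta>) exponent_dom" "mat_holomorphic_on (\<lambda>a. Hi a \<eta>) exponent_dom"
    if "\<eta> \<in> cut_plane" for \<eta>
    unfolding H_def Hi_def
    by (intro mat_holomorphic_on_mat2 holomorphic_intros hol nz that)+
  have hs: "h_inf a \<eta> = h a \<eta>" "s_inf a \<eta> = s a \<eta>"
    if a: "a \<in> exponent_dom" "a \<noteq> 0" and \<eta>: "\<eta> \<in> cut_plane" for a \<eta>
  proof -
    note p = exponent_dom_param[OF a(1)]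
    show "h_inf a \<eta> = h a \<eta>"
      unfolding h_inf_def h_def C_def by (rule cont[OF p(1,3) \<eta>])
    have "- (- a - 1) = a + 1" "- a - 1 + 1 = - a" "2 * (- a - 1) + 2 = - 2 * a" by simp_all
    with cont[OF p(2) p(4)[OF a(2)] \<eta>, of "C' a"] show "s_inf a \<eta> = s a \<eta>"
      unfolding s_inf_def s_def C'_def by (simp only:)
  qed
  have GH: "Gamma_hat a \<eta> = H a \<eta>" if a: "a \<in> exponent_dom" "a \<noteq> 0" and \<eta>: "\<eta> \<in> cut_plane" for a \<eta>
  proof -
    have "(h a has_field_derivative h' a \<eta>) (at \<eta>)" "(s a has_field_derivative s' a \<eta>) (at \<eta>)"
      unfolding h_def s_def h'_def s'_def by (intro DERIV_cmult dK \<eta>)+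
    then have "(h_inf a has_field_derivative h' a \<eta>) (at \<eta>)" "(s_inf a has_field_derivative s' a \<eta>) (at \<eta>)"
      using hs[OF a] by (metis has_field_derivative_transform_within_open open_cut_plane \<eta>)+
    then show ?thesis
      unfolding Gamma_hat_def H_def using hs[OF a \<eta>] by (simp add: DERIV_imp_deriv)
  qed
  moreover have "matrix_inv (Gamma_hat a \<eta>) = Hi a \<eta>"
    if a: "a \<in> exponent_dom" "a \<noteq> 0" and \<eta>: "\<eta> \<in> cut_plane" for a \<eta>
  proof -
    note p = exponent_dom_param[OF a(1)]
    have "C a * C' a = -1" by (simp add: C_def C'_def flip: exp_add)
    moreover have "h a \<eta> * s' a \<eta> - s a \<eta> * h' a \<eta> = (C a * C' a) * (K a \<eta> * K' (- a - 1) \<eta> - K' a \<eta> * K (- a - 1) \<eta>)"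
      by (simp add: h_def s_def h'_def s'_def algebra_simps)
    ultimately have "- (2 * a + 1) = h a \<eta> * s' a \<eta> - s a \<eta> * h' a \<eta>"
      using wr[OF p(1,2) \<eta>] by simp
    then show ?thesis
      using nz[OF a(1)] unfolding GH[OF a \<eta>] unfolding H_def Hi_def by (rule matrix_inv_mat2)
  qed
  ultimately show thesis using that[of H Hi] H by blast
qed

lemma Q_conjugation_analytic:
  assumes "mat_holomorphic_on Y exponent_dom"
  obtains Z where "mat_holomorphic_on Z exponent_dom"
    "\<And>a. a \<in> exponent_dom \<Longrightarrow> a \<noteq> 0 \<Longrightarrow> matrix_inv (Q_mat a) ** Y a ** Q_mat a = Z a"
proof -
  define e where "e = (\<lambda>a. exp (a * of_real pi * \<i>))"
  define N where "N = (\<lambda>a. mat2 1 (e a) (- e a) 1)"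
  define Ni where "Ni = (\<lambda>a. mat2 (1 / (1 + (e a)\<^sup>2)) (- e a / (1 + (e a)\<^sup>2)) (e a / (1 + (e a)\<^sup>2)) (1 / (1 + (e a)\<^sup>2)))"
  \<comment> \<open>Conjugation by a diagonal matrix fixes the diagonal and scales the off-diagonal
    entries by d2/d1 and d1/d2, so \<open>X\<close> remains defined at a = 0 although d1 vanishes
    there.\<close>
  define X where "X = (\<lambda>a. mat2 (Y a $ 1 $ 1) (diag_quot a * Y a $ 1 $ 2) (Y a $ 2 $ 1 / diag_quot a) (Y a $ 2 $ 2))"
  define Z where "Z = (\<lambda>a. Ni a ** X a ** N a)"
  have nz: "1 + (e a)\<^sup>2 \<noteq> 0" if "a \<in> exponent_dom" for a
    using exp_pi_nonzero[of a] that by (auto simp: exponent_dom_def e_def)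
  have Yh: "(\<lambda>a. Y a $ i $ j) holomorphic_on exponent_dom" for i j
    using assms by (simp add: mat_holomorphic_on_def)
  have eh: "e holomorphic_on exponent_dom" unfolding e_def by (intro holomorphic_intros)
  have "mat_holomorphic_on Z exponent_dom"
    unfolding Z_def N_def Ni_def X_def
    by (intro mat_holomorphic_on_mult mat_holomorphic_on_mat2 holomorphic_intros eh Yh holomorphic_diag_quot diag_quot_nonzero nz)
  moreover have "matrix_inv (Q_mat a) ** Y a ** Q_mat a = Z a" if a: "a \<in> exponent_dom" "a \<noteq> 0" for a
  proof -
    define d1 where "d1 = - tan (a * of_real pi)"
    define d2 where "d2 = 4 powr (2 * a + 1) * exp (a * of_real pi * \<i>)
               * (Gamma (a + 3/2) * Gamma (a + 1/2)) / (Gamma a * Gamma (a + 2))"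
    define \<rho> where "\<rho> = diag_quot a"
    have d: "d2 = \<rho> * d1" "d1 \<noteq> 0" "\<rho> \<noteq> 0"
      using diag_quot_eq[OF a] diag_quot_nonzero[OF a(1)] by (simp_all add: d1_def d2_def \<rho>_def)
    have Q: "Q_mat a = mat2 d1 0 0 d2 ** N a" by (simp add: Q_mat_def d1_def d2_def N_def e_def)
    have NiN: "Ni a ** N a = mat 1" "N a ** Ni a = mat 1"
    proof -
      have "1 / (1 + (e a)\<^sup>2) + e a * e a / (1 + (e a)\<^sup>2) = 1"
        using nz[OF a(1)] by (simp add: power2_eq_square flip: add_divide_distrib)
      then show "Ni a ** N a = mat 1" "N a ** Ni a = mat 1"
        by (simp_all add: N_def Ni_def mat2_mult mat_1_eq_mat2 add.commute)
    qed
    define Di where "Di = mat2 (1 / d1) 0 0 (1 / d2)"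
    have D: "Di ** mat2 d1 0 0 d2 = mat 1" "mat2 d1 0 0 d2 ** Di = mat 1"
      using d by (simp_all add: Di_def mat2_mult mat_1_eq_mat2)
    have "matrix_inv (Q_mat a) = Ni a ** Di"
    proof (rule matrix_inv_eqI)
      have "Q_mat a ** (Ni a ** Di) = mat2 d1 0 0 d2 ** (N a ** Ni a) ** Di"
        unfolding Q by (simp add: matrix_mul_assoc)
      then show "Q_mat a ** (Ni a ** Di) = mat 1" by (simp add: NiN D)
      have "Ni a ** Di ** Q_mat a = Ni a ** (Di ** mat2 d1 0 0 d2) ** N a"
        unfolding Q by (simp add: matrix_mul_assoc)
      then show "Ni a ** Di ** Q_mat a = mat 1" by (simp add: NiN D)
    qed
    then have "matrix_inv (Q_mat a) ** Y a ** Q_mat a = Ni a ** (Di ** Y a ** mat2 d1 0 0 d2) ** N a"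
      unfolding Q by (simp add: matrix_mul_assoc)
    moreover have "Y a = mat2 (Y a $ 1 $ 1) (Y a $ 1 $ 2) (Y a $ 2 $ 1) (Y a $ 2 $ 2)"
      by (simp add: vec_eq_iff forall_2)
    then have "Di ** Y a ** mat2 d1 0 0 d2 = Di ** mat2 (Y a $ 1 $ 1) (Y a $ 1 $ 2) (Y a $ 2 $ 1) (Y a $ 2 $ 2) ** mat2 d1 0 0 d2"
      by metis
    then have "Di ** Y a ** mat2 d1 0 0 d2 = X a"
      using d by (simp add: Di_def X_def mat2_mult \<rho>_def[symmetric] mult.commute)
    ultimately show ?thesis by (simp add: Z_def)
  qed
  ultimately show thesis by (rule that)
qed

lemma Gamma_fin_factors:
  assumes b: "bL < 0" "0 < bR" and z: "z \<notin> seg bL bR"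
  obtains \<Phi> where "mat_holomorphic_on \<Phi> exponent_dom"
    "\<And>l. a_exp l \<in> exponent_dom \<Longrightarrow> a_exp l \<noteq> 0 \<Longrightarrow> Gamma_fin bL bR z l = \<Phi> (a_exp l)"
proof -
  obtain H Hi where H: "\<And>\<eta>. \<eta> \<in> cut_plane \<Longrightarrow> mat_holomorphic_on (\<lambda>a. H a \<eta>) exponent_dom"
    "\<And>\<eta>. \<eta> \<in> cut_plane \<Longrightarrow> mat_holomorphic_on (\<lambda>a. Hi a \<eta>) exponent_dom"
    and GH: "\<And>a \<eta>. a \<in> exponent_dom \<Longrightarrow> a \<noteq> 0 \<Longrightarrow> \<eta> \<in> cut_plane \<Longrightarrow> Gamma_hat a \<eta> = H a \<eta>"
    "\<And>a \<eta>. a \<in> exponent_dom \<Longrightarrow> a \<noteq> 0 \<Longrightarrow> \<eta> \<in> cut_plane \<Longrightarrow> matrix_inv (Gamma_hat a \<eta>) = Hi a \<eta>"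
    by (rule Gamma_hat_analytic_in_exponent) (assumption | rule that)+
  have M: "M1 bL bR Infty \<in> cut_plane" "M1 bL bR z \<in> cut_plane"
    using M1_in_cut_plane[OF b, of Infty] M1_in_cut_plane[OF b z] by (auto simp: seg_def)
  define Y where "Y = (\<lambda>a. Hi a (M1 bL bR Infty) ** mat2 1 (upper_entry bL bR a z) 0 1 ** H a (M1 bL bR z))"
  have "(\<lambda>a. upper_entry bL bR a z) holomorphic_on exponent_dom"
  proof (cases z)
    case (Fin x)
    have "0 \<in> {bL..bR}" using b by simp
    then have "x \<noteq> 0" using z by (force simp: seg_def Fin)
    moreover have "complex_of_real bR - of_real bL \<noteq> 0" using b by (simp flip: of_real_diff)
    ultimately show ?thesis
      unfolding Fin upper_entry.simps using exponent_dom_param(6) by (intro holomorphic_intros) auto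
  qed (simp add: holomorphic_on_const)
  then have "mat_holomorphic_on Y exponent_dom"
    unfolding Y_def by (intro mat_holomorphic_on_mult mat_holomorphic_on_mat2 H M holomorphic_on_const)
  then obtain Z where Z: "mat_holomorphic_on Z exponent_dom"
    "\<And>a. a \<in> exponent_dom \<Longrightarrow> a \<noteq> 0 \<Longrightarrow> matrix_inv (Q_mat a) ** Y a ** Q_mat a = Z a"
    by (rule Q_conjugation_analytic) (assumption | rule that)+
  show thesis
  proof (rule that)
    show "mat_holomorphic_on (\<lambda>a. sigma2 ** Z a ** sigma2) exponent_dom"
      unfolding sigma2_def
      by (intro mat_holomorphic_on_mult mat_holomorphic_on_mat2 Z(1) holomorphic_on_const)
    fix l assume l: "a_exp l \<in> exponent_dom" "a_exp l \<noteq> 0"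
    show "Gamma_fin bL bR z l = sigma2 ** Z (a_exp l) ** sigma2"
      unfolding Gamma_fin_def Let_def Z(2)[OF l, symmetric] Y_def GH(1)[OF l M(2)] GH(2)[OF l M(1)]
      by (simp add: matrix_mul_assoc)
  qed
qed

subsection \<open>The exponent as a function of the spectral variable\<close>

abbreviation lambda_dom :: "complex set" where
  "lambda_dom \<equiv> - complex_of_real ` {-1/2..1/2}"

section \<open>The branch of the square root\<close>

lemma lambda_dom_props:
  shows "open lambda_dom" "connected lambda_dom" "0 \<notin> lambda_dom"
proof -
  have comp: "compact (complex_of_real ` {-1/2..1/2})"
    by (intro compact_continuous_image continuous_intros compact_Icc)
  then show "open lambda_dom" by (simp add: compact_imp_closed open_Compl)
  have "convex (complex_of_real ` {-1/2..1/2})"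
    by (intro convex_linear_image bounded_linear.linear bounded_linear_of_real convex_real_interval)
  then show "connected lambda_dom"
    using comp by (intro connected_complement_bounded_convex compact_imp_bounded) auto
  show "0 \<notin> lambda_dom" by (auto simp: image_iff intro!: bexI[of _ 0])
qed

text \<open>The quotient of two branches is continuous with values in {1,-1} on a connected set,
  hence constant. The value -1 would make 4\<lambda> bounded near infinity.\<close>

lemma sqrt_branch_unique:
  assumes r: "is_sqrt_branch r" and s: "is_sqrt_branch s" and l: "l \<in> lambda_dom"
  shows "r l = s l"
proof -
  have rs: "r analytic_on lambda_dom" "s analytic_on lambda_dom"
    "\<And>l. l \<in> lambda_dom \<Longrightarrow> (r l)\<^sup>2 = 4 * l\<^sup>2 - 1" "\<And>l. l \<in> lambda_dom \<Longrightarrow> (s l)\<^sup>2 = 4 * l\<^sup>2 - 1"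
    and O: "(\<lambda>l. r l - 2 * l) \<in> O[at_infinity](\<lambda>_. 1)" "(\<lambda>l. s l - 2 * l) \<in> O[at_infinity](\<lambda>_. 1)"
    using r s by (auto simp: is_sqrt_branch_def)
  have s0: "s l \<noteq> 0" if "l \<in> lambda_dom" for l
  proof
    assume "s l = 0"
    then have "(2 * l - 1) * (2 * l + 1) = 0" using rs(4)[OF that] by (simp add: algebra_simps power2_eq_square)
    then have "2 * l = 1 \<or> 2 * l = -1" by (auto simp: add_eq_0_iff2)
    then have "2 * l / 2 = 1/2 \<or> 2 * l / 2 = -1/2" by presburger
    then have "l = of_real (1/2) \<or> l = of_real (-1/2)" by simp
    moreover have "1/2 \<in> {-1/2..1/2::real}" "-1/2 \<in> {-1/2..1/2::real}" by simp_all
    ultimately show False using that by (metis ComplD imageI)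
  qed
  have q2: "(r l / s l)\<^sup>2 = 1" if "l \<in> lambda_dom" for l
  proof -
    have "(r l)\<^sup>2 = (s l)\<^sup>2" using rs(3,4)[OF that] by simp
    then show ?thesis using s0[OF that] by (simp add: power_divide)
  qed
  have "continuous_on lambda_dom (\<lambda>l. r l / s l)"
    using rs(1,2) s0 by (intro continuous_intros holomorphic_on_imp_continuous_on analytic_imp_holomorphic) auto
  moreover have "(\<lambda>l. r l / s l) ` lambda_dom \<subseteq> {1, -1}"
    using q2 by (intro image_subsetI) (metis insert_iff power2_eq_1_iff)
  then have "finite ((\<lambda>l. r l / s l) ` lambda_dom)" by (rule finite_subset) simp
  ultimately have "(\<lambda>l. r l / s l) constant_on lambda_dom"
    using lambda_dom_props(2) continuous_finite_range_constant by blast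
  then obtain q where q: "\<And>l. l \<in> lambda_dom \<Longrightarrow> r l / s l = q" by (auto simp: constant_on_def)
  have "q\<^sup>2 = 1" using q2[OF l] q[OF l] by simp
  then consider "q = 1" | "q = -1" by (auto simp: power2_eq_1_iff)
  then show ?thesis
  proof cases
    case 1
    then show ?thesis using q[OF l] s0[OF l] by simp
  next
    case 2
    obtain c d where "\<forall>\<^sub>F l in at_infinity. norm (r l - 2 * l) \<le> c" "\<forall>\<^sub>F l in at_infinity. norm (s l - 2 * l) \<le> d"
      using O by (auto elim!: landau_o.bigE)
    then have "\<forall>\<^sub>F l::complex in at_infinity. norm (r l - 2 * l) \<le> c \<and> norm (s l - 2 * l) \<le> d"
      by (rule eventually_conj)
    then obtain B where B: "\<And>l. B \<le> norm l \<Longrightarrow> norm (r l - 2 * l) \<le> c \<and> norm (s l - 2 * l) \<le> d"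
      by (auto simp: eventually_at_infinity)
    \<comment> \<open>Large enough for both bounds to apply and for 4t \<le> c + d \<le> t to be
      absurd.\<close>
    define t where "t = max (max B 1) (c + d)"
    have t: "B \<le> t" "1 \<le> t" "c + d \<le> t" by (auto simp: t_def)
    define l where "l = complex_of_real t"
    have nl: "norm l = t" using t by (simp add: l_def)
    have "l \<in> lambda_dom" using t by (auto simp: l_def image_iff)
    then have "r l = - s l" using q[of l] s0[of l] 2 by (simp add: field_simps)
    then have "norm (4 * l) = norm ((r l - 2 * l) + (s l - 2 * l))" by (simp add: norm_minus_commute)
    also have "\<dots> \<le> c + d" using B[of l] t nl by (intro norm_triangle_le) auto
    finally show ?thesis using t nl by (simp add: norm_mult)
  qed
qed

text \<open>The complement of the two branch cuts of \<open>Arcsin\<close>. It contains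
  1/(2\<lambda>) for every \<lambda> off the segment, as well as 0, the value at \<lambda> =
  \<infinity>.\<close>

definition off_arcs :: "complex \<Rightarrow> bool" where
  "off_arcs u \<longleftrightarrow> (Im u = 0 \<longrightarrow> \<bar>Re u\<bar> < 1)"

lemma one_minus_square_not_nonpos:
  assumes "off_arcs u"
  shows "1 - u\<^sup>2 \<notin> \<real>\<^sub>\<le>\<^sub>0"
proof
  assume "1 - u\<^sup>2 \<in> \<real>\<^sub>\<le>\<^sub>0"
  then have i: "Re u * Im u = 0" and r: "1 \<le> (Re u)\<^sup>2 - (Im u)\<^sup>2"
    by (auto simp: complex_nonpos_Reals_iff power2_eq_square)
  have "Re u \<noteq> 0"
  proof
    assume "Re u = 0"
    then show False using r zero_le_power2[of "Im u"] by simp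
  qed
  then have "Im u = 0" using i by simp
  then have "1 \<le> (Re u)\<^sup>2" using r by simp
  then have "1 \<le> \<bar>Re u\<bar>" by (metis abs_ge_zero abs_square_less_1 not_le)
  with assms \<open>Im u = 0\<close> show False by (simp add: off_arcs_def)
qed

text \<open>The argument w of the logarithm satisfies w + 1/w = 2c with Re c > 0. Since w and 1/w
  have real parts of the same sign, Re w > 0, and the real part of \<open>Arcsin\<close> is the
  argument of w.\<close>

lemma Re_Arcsin_off_arcs:
  assumes "off_arcs u"
  shows "\<bar>Re (Arcsin u)\<bar> < pi / 2"
proof -
  define c where "c = csqrt (1 - u\<^sup>2)"
  define w where "w = \<i> * u + c"
  have c2: "c\<^sup>2 = 1 - u\<^sup>2" by (simp add: c_def)
  have "0 < Re c"
  proof (rule ccontr)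
    assume "\<not> 0 < Re c"
    then have "Re c = 0" using csqrt_principal[of "1 - u\<^sup>2"] by (auto simp: c_def)
    then have "c\<^sup>2 \<in> \<real>\<^sub>\<le>\<^sub>0" by (simp add: complex_nonpos_Reals_iff power2_eq_square)
    then show False using one_minus_square_not_nonpos[OF assms] c2 by simp
  qed
  have w1: "w * (c - \<i> * u) = 1"
    using c2 by (simp add: w_def algebra_simps power2_eq_square)
  then have "w \<noteq> 0" by auto
  then have "inverse w = c - \<i> * u" using w1 by (metis inverse_unique)
  then have "w + inverse w = 2 * c" by (simp add: w_def)
  then have "Re w + Re (inverse w) = 2 * Re c" by (metis Re_complex_of_real mult_2 plus_complex.sel(1))
  then have "Re w * (1 + 1 / (norm w)\<^sup>2) = 2 * Re c"
    by (simp add: inverse_complex.sel cmod_power2 distrib_left)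
  then have "0 < Re w * (1 + 1 / (norm w)\<^sup>2)" using \<open>0 < Re c\<close> by simp
  moreover have "0 < 1 + 1 / (norm w)\<^sup>2" by (simp add: add_pos_nonneg)
  ultimately have "0 < Re w" by (simp add: zero_less_mult_iff)
  then show ?thesis
    unfolding Re_Arcsin w_def c_def by (rule Re_Ln_pos_lt_imp)
qed

lemma off_arcs_inverse:
  assumes "l \<in> lambda_dom"
  shows "off_arcs (1 / (2 * l))"
  unfolding off_arcs_def
proof (intro impI, rule ccontr)
  assume im: "Im (1 / (2 * l)) = 0" and re: "\<not> \<bar>Re (1 / (2 * l))\<bar> < 1"
  define t where "t = Re (1 / (2 * l))"
  have "1 / (2 * l) = of_real t" using im by (simp add: t_def complex_eq_iff)
  moreover have "1 \<le> \<bar>t\<bar>" using re by (auto simp: t_def)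
  moreover have "l = 1 / (2 * (1 / (2 * l)))" by simp
  ultimately have "l = of_real (1 / (2 * t))" by simp
  moreover have "\<bar>1 / (2 * t)\<bar> \<le> 1/2" using \<open>1 \<le> \<bar>t\<bar>\<close> by (simp add: abs_divide abs_mult field_simps)
  moreover have "q \<in> {-1/2..1/2}" if "\<bar>q\<bar> \<le> 1/2" for q :: real using that by auto
  ultimately show False using assms by blast
qed

text \<open>With u = 1/(2\<lambda>), the explicit branch divided by 2\<lambda> is
  \<open>csqrt (1 - u\<^sup>2)\<close>, and 1/(i \<pi>) = -i/\<pi>; this is the logarithmic formula
  defining \<open>Arcsin u\<close>.\<close>

lemma a_exp_eq_Arcsin:
  assumes "l \<in> lambda_dom"
  shows "a_exp l = Arcsin (1 / (2 * l)) / of_real pi"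
proof -
  have l0: "l \<noteq> 0" using assms lambda_dom_props(3) by auto
  have "sqrt_branch l = 2 * l * csqrt (1 - 1 / (4 * l\<^sup>2))"
    using sqrt_branch_unique[OF is_sqrt_branch_sqrt_branch is_sqrt_branch_explicit assms] .
  then have "(\<i> + sqrt_branch l) / (2 * l) = \<i> * (1 / (2 * l)) + csqrt (1 - (1 / (2 * l))\<^sup>2)"
    using l0 by (simp add: add_divide_distrib power_divide power_mult_distrib)
  moreover have "1 / (\<i> * of_real pi) = - \<i> / of_real pi" by (simp add: field_simps)
  ultimately show ?thesis
    by (simp only: a_exp_def Arcsin_def) simp
qed

lemma Arcsin_quot_pi_in_dom:
  assumes "off_arcs u"
  shows "Arcsin u / of_real pi \<in> exponent_dom"
proof -
  define a where "a = Arcsin u / of_real pi"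
  have "\<bar>Re a\<bar> < 1/2"
    using Re_Arcsin_off_arcs[OF assms] by (simp add: a_def field_simps)
  then have "a \<in> exponent_dom" by (intro exponent_domI) auto
  then show ?thesis by (simp add: a_def)
qed

lemma Arcsin_nonzero: "u \<noteq> 0 \<Longrightarrow> Arcsin u \<noteq> 0"
  by (metis sin_Arcsin sin_zero)

lemma a_exp_in_dom:
  assumes "l \<in> lambda_dom"
  shows "a_exp l \<in> exponent_dom" "a_exp l \<noteq> 0"
proof -
  have "l \<noteq> 0" using assms lambda_dom_props(3) by metis
  then show "a_exp l \<noteq> 0" unfolding a_exp_eq_Arcsin[OF assms] by (simp add: Arcsin_nonzero)
  show "a_exp l \<in> exponent_dom"
    unfolding a_exp_eq_Arcsin[OF assms] by (intro Arcsin_quot_pi_in_dom off_arcs_inverse assms)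
qed

lemma holomorphic_Arcsin_off_arcs: "(\<And>u. u \<in> S \<Longrightarrow> off_arcs u) \<Longrightarrow> Arcsin holomorphic_on S"
  by (rule holomorphic_on_Arcsin) (auto simp: off_arcs_def)

lemma holomorphic_a_exp: "a_exp holomorphic_on lambda_dom"
proof -
  have "(\<lambda>l. 1 / (2 * l)) holomorphic_on lambda_dom"
    using lambda_dom_props(3) by (intro holomorphic_intros) auto
  moreover have "Arcsin holomorphic_on (\<lambda>l. 1 / (2 * l)) ` lambda_dom"
    using off_arcs_inverse by (intro holomorphic_Arcsin_off_arcs) auto
  ultimately have "(Arcsin \<circ> (\<lambda>l. 1 / (2 * l))) holomorphic_on lambda_dom"
    by (rule holomorphic_on_compose)
  then have "(\<lambda>l. Arcsin (1 / (2 * l)) / of_real pi) holomorphic_on lambda_dom"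
    by (intro holomorphic_intros) (simp_all add: o_def)
  then show ?thesis
    by (rule holomorphic_transform) (simp add: a_exp_eq_Arcsin)
qed

text \<open>
  Across a point of \<open>(-1/2,1/2) - {0}\<close> the exponent continues by replacing
  \<open>csqrt (1 - u\<^sup>2)\<close> with \<open>\<plusminus> \<i> * csqrt (u\<^sup>2 - 1)\<close>, which is analytic there.
\<close>

lemma a_exp_continuation:
  assumes x: "x \<noteq> 0" "\<bar>x\<bar> < 1/2" and \<tau>: "\<tau> \<in> {1, -1::real}"
  obtains U A where "open U" "complex_of_real x \<in> U" "A holomorphic_on U" "A ` U \<subseteq> exponent_dom"
    "\<And>l. l \<in> U \<Longrightarrow> 0 < \<tau> * Im l \<Longrightarrow> A l = a_exp l"
proof -
  \<comment> \<open>The sign that makes i \<sigma> \<open>csqrt (u\<^sup>2 - 1)\<close> the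
    principal root of 1 - u^2 on the chosen side: Re u has the sign of x near x, and Im u the sign
    opposite to that of Im \<lambda>.\<close>
  define \<sigma> where "\<sigma> = \<tau> * sgn x"
  have \<sigma>: "\<sigma> * \<sigma> = 1" "\<sigma> \<noteq> 0" using \<tau> x(1) by (auto simp: \<sigma>_def sgn_real_def)
  define u where "u = (\<lambda>l::complex. 1 / (2 * l))"
  define w where "w = (\<lambda>l. \<i> * (u l + of_real \<sigma> * csqrt ((u l)\<^sup>2 - 1)))"
  define A where "A = (\<lambda>l. - \<i> * Ln (w l) / of_real pi)"
  define V where "V = {l. 0 < x * Re l}"
  have V0: "l \<noteq> 0" if "l \<in> V" for l using that by (auto simp: V_def)
  have "open V" unfolding V_def by (intro open_Collect_less continuous_intros)
  have uh: "u holomorphic_on V" unfolding u_def by (intro holomorphic_intros) (use V0 in auto)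
  \<comment> \<open>The neighbourhood is cut down three times: \<open>U1\<close> makes the root
    analytic, \<open>U2\<close> the logarithm, and \<open>U\<close> keeps the values in
    \<open>exponent_dom\<close>.\<close>
  define U1 where "U1 = V \<inter> u -` {y. 0 < Re (y\<^sup>2 - 1)}"
  have "open U1" unfolding U1_def
    by (intro continuous_open_preimage holomorphic_on_imp_continuous_on uh \<open>open V\<close> open_Collect_less continuous_intros)
  have uh1: "u holomorphic_on U1" using uh by (rule holomorphic_on_subset) (auto simp: U1_def)
  have wh: "w holomorphic_on U1"
    unfolding w_def by (intro holomorphic_intros uh1) (auto simp: U1_def complex_nonpos_Reals_iff)
  define U2 where "U2 = U1 \<inter> w -` (- \<real>\<^sub>\<le>\<^sub>0)"
  have "open U2" unfolding U2_def
    by (intro continuous_open_preimage holomorphic_on_imp_continuous_on wh \<open>open U1\<close> open_Compl closed_nonpos_Reals_complex)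
  have wh2: "w holomorphic_on U2" using wh by (rule holomorphic_on_subset) (auto simp: U2_def)
  have Ah: "A holomorphic_on U2"
    unfolding A_def by (intro holomorphic_intros wh2) (auto simp: U2_def)
  define U where "U = U2 \<inter> A -` exponent_dom"
  have "open U" unfolding U_def
    by (intro continuous_open_preimage holomorphic_on_imp_continuous_on Ah \<open>open U2\<close> open_exponent_dom)
  moreover have "complex_of_real x \<in> U"
  proof -
    define u0 where "u0 = 1 / (2 * x)"
    have u: "u (of_real x) = of_real u0" by (simp add: u_def u0_def)
    have "1 < \<bar>u0\<bar>" using x by (simp add: u0_def abs_divide abs_mult field_simps)
    then have u1: "1 < u0\<^sup>2" by (metis abs_square_le_1 not_le)
    define s where "s = sqrt (u0\<^sup>2 - 1)"
    have s: "0 < s" "s\<^sup>2 = u0\<^sup>2 - 1" using u1 by (auto simp: s_def)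
    have cs: "csqrt ((of_real u0)\<^sup>2 - 1) = of_real s"
    proof (rule csqrt_unique)
      show "(complex_of_real s)\<^sup>2 = (of_real u0)\<^sup>2 - 1"
        by (metis s(2) of_real_power of_real_diff of_real_1)
    qed (use s(1) in simp)
    \<comment> \<open>At x the argument of the logarithm is i r with r real. Its reciprocal partner
      u0 - \<sigma> s differs from r by 2 \<sigma> s \<noteq> 0, so \<bar>r\<bar> \<noteq> 1; this
      is what makes Im y nonzero.\<close>
    define r where "r = u0 + \<sigma> * s"
    have rr: "r * (u0 - \<sigma> * s) = 1"
    proof -
      have "r * (u0 - \<sigma> * s) = u0\<^sup>2 - (\<sigma> * \<sigma>) * s\<^sup>2" by (simp add: r_def algebra_simps power2_eq_square)
      then show ?thesis using \<sigma> s(2) by simp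
    qed
    then have r0: "r \<noteq> 0" by auto
    have w: "w (of_real x) = \<i> * of_real r" by (simp add: w_def u cs r_def)
    then have wn: "w (of_real x) \<notin> \<real>\<^sub>\<le>\<^sub>0" using r0 by (simp add: complex_nonpos_Reals_iff)
    have "of_real x \<in> U1" using x(1) u1 by (auto simp: U1_def V_def u zero_less_mult_iff linorder_neq_iff power2_eq_square)
    then have x2: "of_real x \<in> U2" using wn by (simp add: U2_def)
    define y where "y = A (of_real x)"
    have Ln: "Ln (w (of_real x)) = \<i> * of_real pi * y" by (simp add: y_def A_def)
    have "\<bar>Im (Ln (w (of_real x)))\<bar> < pi"
      using wn r0 w mpi_less_Im_Ln[of "w (of_real x)"] Im_Ln_le_pi[of "w (of_real x)"] Im_Ln_eq_pi[of "w (of_real x)"]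
      by (auto simp: abs_less_iff complex_nonpos_Reals_iff)
    then have "\<bar>Re y\<bar> < 1" unfolding Ln by (simp add: abs_mult)
    moreover have "Im y \<noteq> 0"
    proof
      assume "Im y = 0"
      then have "norm (exp (\<i> * of_real pi * y)) = 1" by simp
      then have "norm (w (of_real x)) = 1" using Ln w r0 by (metis exp_Ln mult_eq_0_iff complex_i_not_zero of_real_eq_0_iff)
      then have "\<bar>r\<bar> = 1" by (simp add: w norm_mult)
      then have "r * r = 1" by (metis abs_mult_self_eq mult_1)
      then have "r * (u0 - \<sigma> * s) = r * r" using rr by simp
      then have "u0 - \<sigma> * s = r" using r0 by simp
      then show False using s(1) \<sigma>(2) by (simp add: r_def)
    qed
    ultimately have "y \<in> exponent_dom" by (intro exponent_domI) auto
    then show ?thesis using x2 by (simp add: U_def y_def)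
  qed
  moreover have "A holomorphic_on U" using Ah by (rule holomorphic_on_subset) (auto simp: U_def)
  moreover have "A ` U \<subseteq> exponent_dom" by (auto simp: U_def)
  moreover have "A l = a_exp l" if l: "l \<in> U" "0 < \<tau> * Im l" for l
  proof -
    have lV: "0 < x * Re l" using l(1) by (simp add: U_def U2_def U1_def V_def)
    have "Im l \<noteq> 0" using l(2) by auto
    then have ld: "l \<in> lambda_dom" by auto
    define v where "v = u l"
    define s where "s = csqrt (v\<^sup>2 - 1)"
    have s2: "s\<^sup>2 = v\<^sup>2 - 1" by (simp add: s_def)
    define N where "N = (Re l)\<^sup>2 + (Im l)\<^sup>2"
    have n: "0 < N" using \<open>Im l \<noteq> 0\<close> by (simp add: N_def sum_power2_gt_zero_iff)
    have N: "4 * (Re l)\<^sup>2 + 4 * (Im l)\<^sup>2 = 4 * N" by (simp add: N_def)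
    have v: "Re v = Re l / (2 * N)" "Im v = - Im l / (2 * N)"
      by (simp_all add: v_def u_def Re_divide Im_divide N)
    \<comment> \<open>The real part of i \<sigma> s is -\<sigma> Im s. Its sign follows from the
      imaginary part of s^2 = v^2 - 1, because Re s \<ge> 0; once positive, it identifies the
      principal root.\<close>
    have "Im s * Re s = Re v * Im v"
      using arg_cong[OF s2, of Im] by (simp add: power2_eq_square mult.commute)
    then have "(\<sigma> * Im s) * Re s = \<sigma> * (Re v * Im v)" by (simp add: mult.assoc)
    also have "\<dots> = - ((\<tau> * Im l) * (sgn x * Re l)) / (4 * N\<^sup>2)"
      by (simp add: v \<sigma>_def power2_eq_square)
    also have "\<dots> < 0"
    proof -
      have "0 < sgn x * Re l" using lV by (auto simp: sgn_real_def zero_less_mult_iff)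
      then have "0 < (\<tau> * Im l) * (sgn x * Re l)" using l(2) by (rule mult_pos_pos[rotated])
      then show ?thesis using n by (simp add: divide_neg_pos)
    qed
    finally have "\<sigma> * Im s < 0"
      using Re_csqrt[of "v\<^sup>2 - 1"] by (simp add: s_def mult_less_0_iff)
    then have "csqrt (1 - v\<^sup>2) = \<i> * of_real \<sigma> * s"
    proof (intro csqrt_unique)
      have "(of_real \<sigma> :: complex)\<^sup>2 = 1" using \<sigma>(1) by (metis of_real_1 of_real_power power2_eq_square)
      then show "(\<i> * of_real \<sigma> * s)\<^sup>2 = 1 - v\<^sup>2" using s2 by (simp add: power_mult_distrib)
    qed simp
    then have "\<i> * v + csqrt (1 - v\<^sup>2) = w l"
      unfolding w_def v_def[symmetric] s_def[symmetric] by (simp add: distrib_left mult.assoc)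
    moreover have "1 / (2 * l) = v" by (simp add: v_def u_def)
    ultimately show ?thesis
      unfolding a_exp_eq_Arcsin[OF ld] Arcsin_def A_def by simp
  qed
  ultimately show thesis by (rule that)
qed

section \<open>Analyticity on the sphere and continuation across the intervals\<close>

lemma holomorphic_on_compose_entry:
  fixes F :: "complex \<Rightarrow> complex^2^2"
  assumes "mat_holomorphic_on F T" "A holomorphic_on S" "A ` S \<subseteq> T"
  shows "(\<lambda>x. F (A x) $ i $ j) holomorphic_on S"
  using holomorphic_on_compose_gen[of A S "\<lambda>a. F a $ i $ j" T] assms
  by (simp add: mat_holomorphic_on_def o_def)

theorem proposition2p5:
  fixes bL bR :: real and z :: csphere
  assumes "bL < 0" and "0 < bR" and "z \<notin> seg bL bR"
  shows "matrix_sphere_analytic_on (Gamma_mat bL bR z) (- seg (-1/2) (1/2)) \<and>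
         continues_from_above (Gamma_mat bL bR z) {-1/2<..<0} \<and>
         continues_from_below (Gamma_mat bL bR z) {-1/2<..<0} \<and>
         continues_from_above (Gamma_mat bL bR z) {0<..<1/2} \<and>
         continues_from_below (Gamma_mat bL bR z) {0<..<1/2}"
proof -
  obtain \<Phi> where \<Phi>: "mat_holomorphic_on \<Phi> exponent_dom"
    and fac: "\<And>l. a_exp l \<in> exponent_dom \<Longrightarrow> a_exp l \<noteq> 0 \<Longrightarrow> Gamma_fin bL bR z l = \<Phi> (a_exp l)"
    by (rule Gamma_fin_factors[OF assms]) (assumption | rule that)+
  have fin: "Gamma_fin bL bR z l = \<Phi> (a_exp l)" if "l \<in> lambda_dom" for l
    using fac a_exp_in_dom[OF that] by blast
  have hol: "(\<lambda>l. Gamma_fin bL bR z l $ i $ j) holomorphic_on lambda_dom" for i j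
  proof -
    have "(\<lambda>l. \<Phi> (a_exp l) $ i $ j) holomorphic_on lambda_dom"
      using a_exp_in_dom by (intro holomorphic_on_compose_entry[OF \<Phi> holomorphic_a_exp]) auto
    then show ?thesis by (rule holomorphic_transform) (simp add: fin)
  qed
  \<comment> \<open>The exponent in the local coordinate w = 1/\<lambda>, where 1/(2\<lambda>) =
    w/2.\<close>
  define A where "A = (\<lambda>w. Arcsin (w / 2) / of_real pi)"
  have off: "off_arcs (w / 2)" if "w \<in> ball 0 1" for w
    using that abs_Re_le_cmod[of w] by (auto simp: off_arcs_def)
  have Ah: "A holomorphic_on ball 0 1"
  proof -
    have "Arcsin holomorphic_on (\<lambda>w. w / 2) ` ball 0 1"
      using off by (intro holomorphic_Arcsin_off_arcs) auto
    moreover have "(\<lambda>w::complex. w / 2) holomorphic_on ball 0 1" by (intro holomorphic_intros) auto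
    ultimately have "(Arcsin \<circ> (\<lambda>w. w / 2)) holomorphic_on ball 0 1" by (intro holomorphic_on_compose)
    then show ?thesis unfolding A_def by (intro holomorphic_intros) (simp_all add: o_def)
  qed
  have AE: "A ` ball 0 1 \<subseteq> exponent_dom"
    unfolding A_def using off by (blast intro: Arcsin_quot_pi_in_dom)
  have \<Phi>Ah: "(\<lambda>w. \<Phi> (A w) $ i $ j) holomorphic_on ball 0 1" for i j
    by (rule holomorphic_on_compose_entry[OF \<Phi> Ah AE])
  have near: "Gamma_fin bL bR z (1 / w) = \<Phi> (A w)" if w: "w \<in> ball 0 1" "w \<noteq> 0" for w
  proof -
    have "1 < norm (1 / w)" using w by (simp add: norm_divide)
    moreover have "norm (complex_of_real t) \<le> 1" if "t \<in> {-1/2..1/2}" for t using that by auto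
    ultimately have "1 / w \<in> lambda_dom" by (auto simp: image_iff not_le)
    then show ?thesis by (simp add: fin a_exp_eq_Arcsin A_def)
  qed
  \<comment> \<open>The value at \<open>Infty\<close> is a \<open>Lim\<close>, so convergence has to
    be proved before it can be evaluated. Here \<open>A 0\<close> is 0, the exponent at which
    \<open>fac\<close> says nothing; continuity of \<open>\<Phi>\<close> at that point supplies the
    limit.\<close>
  have "(Gamma_fin bL bR z \<longlongrightarrow> \<Phi> (A 0)) at_infinity"
  proof -
    have "((\<lambda>w. \<Phi> (A w)) \<longlongrightarrow> \<Phi> (A 0)) (at 0)"
    proof (intro vec_tendstoI)
      fix i j
      have "isCont (\<lambda>w. \<Phi> (A w) $ i $ j) 0"
        using holomorphic_on_imp_continuous_on[OF \<Phi>Ah] by (simp add: continuous_on_eq_continuous_at)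
      then show "((\<lambda>w. \<Phi> (A w) $ i $ j) \<longlongrightarrow> \<Phi> (A 0) $ i $ j) (at 0)" by (rule isContD)
    qed
    moreover have "filterlim inverse (at 0) (at_infinity :: complex filter)"
      unfolding filterlim_at eventually_at_infinity using tendsto_inverse_0 by (auto intro!: exI[of _ 1])
    ultimately have "((\<lambda>l. \<Phi> (A (inverse l))) \<longlongrightarrow> \<Phi> (A 0)) at_infinity"
      by (rule filterlim_compose)
    moreover have "\<Phi> (A (inverse l)) = Gamma_fin bL bR z l" if "2 \<le> norm l" for l
    proof -
      have "inverse (norm l) < 1" using that by (simp add: inverse_less_1_iff)
      then have "inverse l \<in> ball 0 1" "inverse l \<noteq> 0"
        using that by (auto simp: norm_inverse)
      from near[OF this] show ?thesis by (simp add: inverse_eq_divide)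
    qed
    then have "\<forall>\<^sub>F l in at_infinity. \<Phi> (A (inverse l)) = Gamma_fin bL bR z l"
      unfolding eventually_at_infinity by blast
    ultimately show ?thesis by (rule Lim_transform_eventually)
  qed
  then have lim: "Gamma_mat bL bR z Infty = \<Phi> (A 0)"
    unfolding Gamma_mat.simps by (intro tendsto_Lim trivial_limit_at_infinity)
  have "sphere_analytic_on (\<lambda>l. Gamma_mat bL bR z l $ i $ j) (- seg (-1/2) (1/2))" for i j
    unfolding sphere_analytic_on_def
  proof (intro conjI impI)
    have "{l. Fin l \<in> - seg (-1/2) (1/2)} = lambda_dom" by (auto simp: seg_def)
    then show "(\<lambda>l. Gamma_mat bL bR z (Fin l) $ i $ j) analytic_on {l. Fin l \<in> - seg (-1/2) (1/2)}"
      using hol lambda_dom_props(1) by (simp add: analytic_on_open)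
    have "(\<lambda>w. if w = 0 then Gamma_mat bL bR z Infty $ i $ j else Gamma_mat bL bR z (Fin (1 / w)) $ i $ j)
        holomorphic_on ball 0 1"
      by (rule holomorphic_transform[OF \<Phi>Ah]) (auto simp: lim near simp del: Gamma_mat.simps(2))
    then show "(\<lambda>w. if w = 0 then Gamma_mat bL bR z Infty $ i $ j else Gamma_mat bL bR z (Fin (1 / w)) $ i $ j)
        analytic_on {0}"
      unfolding analytic_on_def by (auto intro: exI[of _ 1])
  qed
  then have "matrix_sphere_analytic_on (Gamma_mat bL bR z) (- seg (-1/2) (1/2))"
    by (simp add: matrix_sphere_analytic_on_def)
  \<comment> \<open>The sign \<open>\<tau>\<close> selects the upper (1) or the lower (-1)
    half-plane, so both sides are treated at once.\<close>
  moreover have ext: "extends_near (\<lambda>l. Gamma_mat bL bR z (Fin l)) {l. 0 < \<tau> * Im l} (complex_of_real x)"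
    if x: "x \<noteq> 0" "\<bar>x\<bar> < 1/2" and \<tau>: "\<tau> \<in> {1, -1}" for x \<tau>
  proof -
    define H where "H = {l. 0 < \<tau> * Im l}"
    obtain U B where U: "open U" "complex_of_real x \<in> U" "B holomorphic_on U" "B ` U \<subseteq> exponent_dom"
      "\<And>l. l \<in> U \<Longrightarrow> 0 < \<tau> * Im l \<Longrightarrow> B l = a_exp l"
      by (rule a_exp_continuation[OF x \<tau>]) (assumption | rule that)+
    have "open H" unfolding H_def by (intro open_Collect_less continuous_intros)
    have HD: "H \<subseteq> lambda_dom" by (auto simp: H_def)
    \<comment> \<open>On the half-plane \<open>G\<close> must be the given function; outside it,
      \<open>G\<close> is \<open>\<Phi>\<close> of the continued exponent and need not agree with
      \<open>Gamma_mat\<close>. The two formulas match on the overlap of \<open>H\<close> and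
      \<open>U\<close>, which makes \<open>G\<close> analytic on the union.\<close>
    define G where "G = (\<lambda>l. if l \<in> H then Gamma_fin bL bR z l else \<Phi> (B l))"
    have "(\<lambda>l. G l $ i $ j) holomorphic_on H \<union> U" for i j
    proof -
      have "(\<lambda>l. if l \<in> H then Gamma_fin bL bR z l $ i $ j else \<Phi> (B l) $ i $ j) holomorphic_on H \<union> U"
      proof (rule holomorphic_on_If_Un)
        show "(\<lambda>l. Gamma_fin bL bR z l $ i $ j) holomorphic_on H" using hol HD by (rule holomorphic_on_subset)
        show "(\<lambda>l. \<Phi> (B l) $ i $ j) holomorphic_on U" by (rule holomorphic_on_compose_entry[OF \<Phi> U(3,4)])
        fix l assume l: "l \<in> H" "l \<in> U"
        then have "B l = a_exp l" using U(5) by (simp add: H_def)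
        then show "Gamma_fin bL bR z l $ i $ j = \<Phi> (B l) $ i $ j" using fin[of l] HD l(1) by auto
      qed fact+
      then show ?thesis unfolding G_def by (simp add: if_distrib[of "\<lambda>M. M $ i $ j"])
    qed
    then have "\<forall>i j. (\<lambda>l. G l $ i $ j) analytic_on H \<union> U"
      using \<open>open H\<close> U(1) by (simp add: analytic_on_open open_Un)
    then show ?thesis
      unfolding extends_near_def H_def[symmetric] using U(1,2)
      by (intro exI[of _ U] exI[of _ G]) (simp add: G_def)
  qed
  have above: "continues_from_above (Gamma_mat bL bR z) I" and below: "continues_from_below (Gamma_mat bL bR z) I"
    if "\<And>x. x \<in> I \<Longrightarrow> x \<noteq> 0 \<and> \<bar>x\<bar> < 1/2" for I
    using ext[of _ 1] ext[of _ "-1"] that by (auto simp: continues_from_above_def continues_from_below_def)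
  ultimately show ?thesis by (intro conjI above below) auto
qed

end
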